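(* Let $V=\bigoplus_{n\ge0}V^n$ be a vertex operator algebra over $\mathbb C$ of rank $c$ with $V^0=\mathbb C\mathbf 1$ and $V^1=0$, let $B=V^2$ be its Griess algebra, $d=\dim B$, and suppose the form $(\ |\ )$ on $B$ is nondegenerate and that $B$ contains a proper idempotent. (i) If $V$ is of class $\mathcal S^6$ and $c(2c-1)(5c+22)(7c+68)\ne0$, then $$d=\frac{(70c^2+955c+2388)c}{2(c^2-55c+748)}.$$ (ii) If $V$ is of class $\mathcal S^8$ and $c(2c-1)(3c+46)(5c+3)(5c+22)(7c+68)\ne0$, then moreover $$d=\frac{5250c^5+155250c^4+1369715c^3+3507098c^2+1497768c}{125c^4-4770c^3-23382c^2+1561868c+1032240}.$$
   Context: A VOA $V$ has products $a_{(n)}b$, vacuum $\mathbf 1$, conformal vector $\omega$, $L_m=\omega_{(m+1)}$; the rank is the central charge; $V^n$ is the (finite-dimensional) $L_0$-eigenspace with eigenvalue $n$; $V^{\le n}=\bigoplus_{m\le n}V^m$. The Griess algebra $B=V^2$ has product $ab=a_{(1)}b$ and bilinear form $(a|b)\mathbf 1=a_{(3)}b$. $\mathrm{Aut}\,V$ is the group of linear automorphisms preserving all products and fixing $\omega$. $V_\omega$ is the Virasoro submodule generated by $\mathbf 1$. $V$ is of class $\mathcal S^n$ if the action of $\mathrm{Aut}\,V$ on $V^{\le n}/(V_\omega\cap V^{\le n})$ has no nonzero fixed vector. An idempotent is a vector $e\in B$ with $e_{(1)}e=2e$; its central charge is $2(e|e)$. It is proper if its central charge is different from $0$ and $c$.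 *)

theory Defs
  imports Complex_Main "HOL-Library.Groups_Big_Fun"
begin

text \<open>
  \<open>prd a n b\<close> is the product $a_{(n)}b$. Both sums in the Borcherds identity have only finitely
  many nonzero terms, by \<open>truncation\<close>; this matters because \<^const>\<open>Sum_any\<close> is 0 on functions
  of infinite support. Upper arguments of binomial coefficients may be negative.
\<close>

locale vertex_algebra = vector_space scale
  for scale :: "complex \<Rightarrow> 'v::ab_group_add \<Rightarrow> 'v" (infixr "*s" 75) +
  fixes prd :: "'v \<Rightarrow> int \<Rightarrow> 'v \<Rightarrow> 'v"
    and vac :: 'v
  assumes linear_left: "Vector_Spaces.linear scale scale (\<lambda>a. prd a n b)"
    and linear_right: "Vector_Spaces.linear scale scale (\<lambda>b. prd a n b)"
    and truncation: "\<exists>N. \<forall>n\<ge>N. prd a n b = 0"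
    and borcherds:
      "Sum_any (\<lambda>i. (of_int p gchoose i) *s prd (prd a (r + int i) b) (p + q - int i) x) =
       Sum_any (\<lambda>i. ((- 1) ^ i * (of_int r gchoose i)) *s
         (prd a (p + r - int i) (prd b (q + int i) x)
          - (- 1) powi r *s prd b (q + r - int i) (prd a (p + int i) x)))"
    and vac_nonzero: "vac \<noteq> 0"
    and vac_left: "prd vac n a = (if n = - 1 then a else 0)"
    and vac_right_nonneg: "n \<ge> 0 \<Longrightarrow> prd a n vac = 0"
    and vac_right: "prd a (- 1) vac = a"

text \<open>
  The modes are $L_m = \omega_{(m+1)}$, so \<open>prd om 0\<close> is $L_{-1}$ and \<open>prd om 1\<close> is $L_0$.
  In \<open>grading\<close> only spanning has to be required: the sum of the $L_0$-eigenspaces is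
  automatically direct.
\<close>

locale vertex_operator_algebra = vertex_algebra scale prd vac
  for scale :: "complex \<Rightarrow> 'v::ab_group_add \<Rightarrow> 'v" (infixr "*s" 75)
    and prd :: "'v \<Rightarrow> int \<Rightarrow> 'v \<Rightarrow> 'v"
    and vac :: 'v +
  fixes om :: 'v and c :: complex
  assumes virasoro:
      "prd om (m + 1) (prd om (n + 1) a) - prd om (n + 1) (prd om (m + 1) a) =
       of_int (m - n) *s prd om (m + n + 1) a
       + (if m + n = 0 then of_int (m ^ 3 - m) / 12 * c else 0) *s a"
    and translation: "prd (prd om 0 a) n b = - (of_int n *s prd a (n - 1) b)"
    and grading: "span (\<Union>k::nat. {a. prd om 1 a = of_nat k *s a}) = UNIV"
    and finite_dim: "\<exists>S. finite S \<and> {a. prd om 1 a = of_nat k *s a} \<subseteq> span S"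
begin

definition L :: "int \<Rightarrow> 'v \<Rightarrow> 'v"
  where "L m a = prd om (m + 1) a"

definition wt :: "nat \<Rightarrow> 'v set"
  where "wt n = {a. L 0 a = of_nat n *s a}"

definition wt_upto :: "nat \<Rightarrow> 'v set"
  where "wt_upto n = span (\<Union>m\<le>n. wt m)"

definition griess :: "'v set"
  where "griess = wt 2"

text \<open>The form is meant for arguments in \<^const>\<open>griess\<close> when \<open>wt 0 = span {vac}\<close>.\<close>

definition form :: "'v \<Rightarrow> 'v \<Rightarrow> complex"
  where "form a b = (THE k. prd a 3 b = k *s vac)"

definition form_nondegenerate :: bool
  where "form_nondegenerate \<longleftrightarrow> (\<forall>a\<in>griess. (\<forall>b\<in>griess. form a b = 0) \<longrightarrow> a = 0)"

definition Aut :: "('v \<Rightarrow> 'v) set"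
  where "Aut = {g. Vector_Spaces.linear scale scale g \<and> bij g \<and>
    (\<forall>a n b. g (prd a n b) = prd (g a) n (g b)) \<and> g om = om}"

definition vir_sub :: "'v set"
  where "vir_sub = \<Inter>{W. subspace W \<and> vac \<in> W \<and> (\<forall>m. \<forall>w\<in>W. L m w \<in> W)}"

definition quotient_space :: "'v set \<Rightarrow> 'v set \<Rightarrow> 'v set set"
  where "quotient_space U W = (\<lambda>v. (\<lambda>w. v + w) ` W) ` U"

text \<open>
  Elements of the quotient are cosets, on which an automorphism \<open>g\<close> acts by taking images;
  the zero vector of the quotient is the coset \<open>vir_sub \<inter> wt_upto n\<close> itself.
\<close>

definition class_S :: "nat \<Rightarrow> bool"
  where "class_S n \<longleftrightarrow>
    (\<forall>X \<in> quotient_space (wt_upto n) (vir_sub \<inter> wt_upto n).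
      (\<forall>g\<in>Aut. g ` X = X) \<longrightarrow> X = vir_sub \<inter> wt_upto n)"

definition idempotent :: "'v \<Rightarrow> bool"
  where "idempotent e \<longleftrightarrow> e \<in> griess \<and> prd e 1 e = 2 *s e"

definition central_charge :: "'v \<Rightarrow> complex"
  where "central_charge e = 2 * form e e"

definition proper_idempotent :: "'v \<Rightarrow> bool"
  where "proper_idempotent e \<longleftrightarrow>
    idempotent e \<and> central_charge e \<noteq> 0 \<and> central_charge e \<noteq> c"

end

end

theory Submission
  imports Defs
begin

text \<open>
  Let $B$ be the Griess algebra, of dimension $d$, and let $\kappa_n=\sum_s s^*_{(3-n)}s$ be the Casimir vectors formed
  from dual bases of $B$. They are fixed by all automorphisms (\<open>Aut_casimir\<close>), so by the class
  condition they lie in the Virasoro submodule (\<open>class_S_fixed_point\<close>). In each even weight they are thus combinations of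
  finitely many Virasoro words. As long as $c$ is not one of the excluded numbers, at which the Gram determinants
  vanish, the coefficients are determined by applying positive Virasoro modes,
  which map $\kappa_n$ to known vectors and multiples of $\kappa_m$ with $m<n$, and finally to $\kappa_0=d\,\mathbf 1$
  (\<open>L_casimir\<close>).

  On the other hand, for $a\in B$ the functional $a_{(q+1)}a_{(q+1)}$ takes a value on $\kappa_{2q}$ that
  involves only $(a|a)$ and the traces on $B$ of the multiplication by $aa$ and of the square of the
  multiplication by $a$ (\<open>mode_mode_casimir\<close>). The first trace is known from $\kappa_2$. Hence each of the weights 4, 6
  and 8 yields a formula for the second trace as $(a|a)$ times a function of $c$ and $d$, provided that
  $(a|\omega)=0$ (\<open>trace_4\<close>, \<open>trace_6\<close>, \<open>trace_8\<close>). A proper idempotent supplies such an $a$ with $(a|a)\ne0$, and then the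
  formulas must agree. Weights 4 and 6 give the dimension for class $\mathcal S^6$. Weights 6 and 8 differ by a multiple of
  $(d-1)(c-24)(5c+44)(5c-142)$; since $d\ne1$, this leaves three values of $c$, at which the two
  rational functions of the theorem coincide.
\<close>

section \<open>Commutators and the weight grading\<close>

context vertex_algebra
begin

lemmas prd_left = Vector_Spaces.linear.axioms(3)[OF linear_left]
lemmas prd_right = Vector_Spaces.linear.axioms(3)[OF linear_right]

lemma prd_add_left [simp]: "prd (a + a') n b = prd a n b + prd a' n b"
  and prd_scale_left [simp]: "prd (k *s a) n b = k *s prd a n b"
  and prd_zero_left [simp]: "prd 0 n b = 0"
  and prd_diff_left [simp]: "prd (a - a') n b = prd a n b - prd a' n b"
  and prd_sum_left: "prd (sum f A) n b = (\<Sum>x\<in>A. prd (f x) n b)"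
  using module_hom.add[OF prd_left, of a a' n b] module_hom.scale[OF prd_left, of k a n b]
    module_hom.zero[OF prd_left, of n b] module_hom.diff[OF prd_left, of a a' n b]
    module_hom.sum[OF prd_left, of f A n b] by simp_all

lemma prd_add_right [simp]: "prd a n (b + b') = prd a n b + prd a n b'"
  and prd_scale_right [simp]: "prd a n (k *s b) = k *s prd a n b"
  and prd_zero_right [simp]: "prd a n 0 = 0"
  and prd_diff_right [simp]: "prd a n (b - b') = prd a n b - prd a n b'"
  and prd_sum_right: "prd a n (sum f A) = (\<Sum>x\<in>A. prd a n (f x))"
  using module_hom.add[OF prd_right, of a n b b'] module_hom.scale[OF prd_right, of a n k b]
    module_hom.zero[OF prd_right, of a n] module_hom.diff[OF prd_right, of a n b b']
    module_hom.sum[OF prd_right, of a n f A] by simp_all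

text \<open>
  The case \<open>r = 0\<close> of the Borcherds identity. The hypothesis asks only for the vanishing of
  the products with their binomial coefficients, so that it also covers \<open>m \<ge> 0\<close>, where the
  coefficients stop, without knowing that $a_{(j)}b$ vanishes for large $j$.
\<close>

lemma commutator:
  assumes "\<And>j. j \<ge> N \<Longrightarrow> (of_int m gchoose j) *s prd (prd a (int j) b) (m + n - int j) x = 0"
  shows "prd a m (prd b n x) - prd b n (prd a m x) =
    (\<Sum>j<N. (of_int m gchoose j) *s prd (prd a (int j) b) (m + n - int j) x)"
proof -
  let ?f = "\<lambda>i. ((- 1) ^ i * ((of_int 0 :: complex) gchoose i)) *s
         (prd a (m + 0 - int i) (prd b (n + int i) x)
          - (- 1) powi 0 *s prd b (n + 0 - int i) (prd a (m + int i) x))"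
  have z: "?f i = 0" if "i \<noteq> 0" for i
    using that by (simp add: gbinomial_0_left)
  have "Sum_any ?f = (\<Sum>i\<in>{0}. ?f i)"
    by (rule Sum_any.expand_superset) (use z in force)+
  also have "\<dots> = prd a m (prd b n x) - prd b n (prd a m x)"
    by simp
  finally have r: "Sum_any ?f = prd a m (prd b n x) - prd b n (prd a m x)" .
  let ?g = "\<lambda>i. (of_int m gchoose i) *s prd (prd a (0 + int i) b) (m + n - int i) x"
  have z: "?g i = 0" if "i \<ge> N" for i
    using assms[OF that] by simp
  have l: "Sum_any ?g = (\<Sum>i<N. ?g i)"
    by (rule Sum_any.expand_superset) (use z in \<open>force simp: not_less[symmetric]\<close>)+
  show ?thesis
    using borcherds[of m a 0 b n x] r l by simp
qed

lemma vac_coeff_eq: "k *s vac = k' *s vac \<longleftrightarrow> k = k'"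
  using vac_nonzero by simp

end

context vertex_operator_algebra
begin

lemma L_add [simp]: "L m (x + y) = L m x + L m y"
  and L_scale [simp]: "L m (k *s x) = k *s L m x"
  and L_zero [simp]: "L m 0 = 0"
  and L_diff [simp]: "L m (x - y) = L m x - L m y"
  and L_sum: "L m (sum f A) = (\<Sum>x\<in>A. L m (f x))"
  by (simp_all add: L_def prd_sum_right)

lemma L_vac: "m \<ge> - 1 \<Longrightarrow> L m vac = 0"
  by (simp add: L_def vac_right_nonneg)

lemma L_om: "L (- 2) vac = om"
  by (simp add: L_def vac_right)

lemma L_comm:
  "L m (L n v) = L n (L m v) + of_int (m - n) *s L (m + n) v
     + (if m + n = 0 then of_int (m ^ 3 - m) / 12 * c else 0) *s v"
  using virasoro[of m n v] by (simp add: L_def algebra_simps)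

lemma subspace_wt: "subspace (wt n)"
  by (rule subspaceI) (auto simp: wt_def scale_right_distrib scale_left_commute)

lemma subspace_griess: "subspace griess"
  by (simp add: griess_def subspace_wt)

lemma eigenvectors_independent:
  assumes "finite K" "\<And>\<mu>. \<mu> \<in> K \<Longrightarrow> L 0 (w \<mu>) = \<mu> *s w \<mu>" "(\<Sum>\<mu>\<in>K. w \<mu>) = 0" "\<mu> \<in> K"
  shows "w \<mu> = 0"
  using assms
proof (induction K arbitrary: w \<mu> rule: finite_induct)
  case (insert \<nu> K)
  let ?w = "\<lambda>\<mu>. (\<mu> - \<nu>) *s w \<mu>"
  have "(\<Sum>\<mu>\<in>K. ?w \<mu>) = (\<Sum>\<mu>\<in>insert \<nu> K. ?w \<mu>)"
    using insert.hyps by simp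
  also have "\<dots> = L 0 (\<Sum>\<mu>\<in>insert \<nu> K. w \<mu>) - \<nu> *s (\<Sum>\<mu>\<in>insert \<nu> K. w \<mu>)"
    unfolding L_sum scale_sum_right sum_subtractf[symmetric]
    by (rule sum.cong) (auto simp: insert.prems(1) scale_left_diff_distrib)
  also have "\<dots> = 0"
    using insert.prems(2) by simp
  finally have s: "(\<Sum>\<mu>\<in>K. ?w \<mu>) = 0" .
  have "?w \<mu> = 0" if "\<mu> \<in> K" for \<mu>
    by (rule insert.IH[of ?w]) (auto simp: insert.prems(1) s that scale_left_commute)
  then have K: "w \<mu> = 0" if "\<mu> \<in> K" for \<mu>
    using that insert.hyps(2) by auto
  then have "(\<Sum>\<mu>\<in>K. w \<mu>) = 0" by simp
  then have "w \<nu> = 0"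
    using insert.prems(2) insert.hyps by simp
  then show ?case using K insert.prems(3) by auto
qed simp

lemma homogeneous_decomposition:
  assumes "v \<in> span (\<Union>k. M \<inter> wt k)"
  shows "\<exists>N w. (\<forall>k. w k \<in> span (M \<inter> wt k)) \<and> v = (\<Sum>k<N. w k)"
  using assms
proof (induction rule: span_induct_alt)
  case base
  show ?case
    by (rule exI[of _ 0], rule exI[of _ "\<lambda>_. 0"]) (simp add: span_zero)
next
  case (step r x y)
  then obtain k N w where x: "x \<in> M \<inter> wt k" and w: "\<And>k. w k \<in> span (M \<inter> wt k)"
    "y = (\<Sum>k<N. w k)" by auto
  let ?u = "\<lambda>i. if i < N then w i else 0"
  let ?w = "\<lambda>i. (if i = k then r *s x else 0) + ?u i"
  have "(\<Sum>i<N + Suc k. ?w i) = r *s x + (\<Sum>i<N + Suc k. ?u i)"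
    by (simp add: sum.distrib del: sum.lessThan_Suc)
  also have "(\<Sum>i<N + Suc k. ?u i) = y"
    unfolding w(2) by (rule sum.mono_neutral_cong_right) auto
  finally have "r *s x + y = (\<Sum>i<N + Suc k. ?w i)" by simp
  moreover have "?w i \<in> span (M \<inter> wt i)" for i
    using x w(1)[of i] by (intro span_add) (auto intro: span_scale span_base simp: span_zero)
  ultimately show ?case
    by (intro exI[of _ "N + Suc k"] exI[of _ ?w] conjI allI)
qed

lemma span_wt: "w \<in> span (M \<inter> wt k) \<Longrightarrow> w \<in> wt k"
  using span_minimal[OF _ subspace_wt, of "M \<inter> wt k" k] by auto

lemma eigenvector_in_span:
  assumes v: "v \<in> span (\<Union>k. M \<inter> wt k)" and e: "L 0 v = \<kappa> *s v"
  shows "(\<kappa> \<notin> \<nat> \<longrightarrow> v = 0) \<and> (\<forall>n. \<kappa> = of_nat n \<longrightarrow> v \<in> span (M \<inter> wt n))"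
proof -
  obtain N w where w: "\<And>k. w k \<in> span (M \<inter> wt k)" and v: "v = (\<Sum>k<N. w k)"
    using homogeneous_decomposition[OF v] by auto
  let ?K = "of_nat ` {..<N} :: complex set"
  let ?K' = "insert \<kappa> ?K"
  define u where "u \<mu> = (if \<mu> \<in> ?K then w (the_inv of_nat \<mu>) else 0) - (if \<mu> = \<kappa> then v else 0)" for \<mu>
  have i: "the_inv of_nat (of_nat k :: complex) = k" for k
    by (rule the_inv_f_f) (rule inj_of_nat)
  have "L 0 (w k) = of_nat k *s w k" for k
    using span_wt[OF w[of k]] by (simp add: wt_def)
  then have 1: "L 0 (u \<mu>) = \<mu> *s u \<mu>" for \<mu>
    by (auto simp: u_def i e scale_right_diff_distrib)
  have "(\<Sum>\<mu>\<in>?K'. u \<mu>) = (\<Sum>\<mu>\<in>?K'. if \<mu> \<in> ?K then w (the_inv of_nat \<mu>) else 0) - v"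
    by (simp add: u_def sum_subtractf)
  also have "(\<Sum>\<mu>\<in>?K'. if \<mu> \<in> ?K then w (the_inv of_nat \<mu>) else 0) = (\<Sum>\<mu>\<in>?K. w (the_inv of_nat \<mu>))"
    by (rule sum.mono_neutral_cong_right) auto
  also have "\<dots> = v"
    unfolding v by (subst sum.reindex) (auto simp: i inj_on_def)
  finally have "(\<Sum>\<mu>\<in>?K'. u \<mu>) = 0" by simp
  then have "u \<kappa> = 0"
    by (intro eigenvectors_independent[of ?K' u]) (auto simp: 1)
  then have "v = (if \<kappa> \<in> ?K then w (the_inv of_nat \<kappa>) else 0)"
    by (simp add: u_def)
  then show ?thesis
    using w by (auto simp: i span_zero split: if_splits)
qed

text \<open>
  Since the $L_0$-eigenspaces with eigenvalues in \<open>\<nat>\<close> span the whole space and eigenvectors for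
  different eigenvalues are independent, no other eigenvalue occurs. This is what makes products of
  negative weight vanish.
\<close>

lemma eigenvalue_nat:
  assumes "L 0 v = \<kappa> *s v" "\<kappa> \<notin> \<nat>"
  shows "v = 0"
proof -
  have "v \<in> span (\<Union>k. UNIV \<inter> wt k)"
    using grading by (simp add: wt_def L_def)
  then show ?thesis
    using eigenvector_in_span[of v UNIV \<kappa>] assms by blast
qed

lemma L0_prd:
  assumes "a \<in> wt h" "b \<in> wt k"
  shows "L 0 (prd a n b) = of_int (int h + int k - n - 1) *s prd a n b"
proof -
  have "prd om 1 (prd a n b) - prd a n (prd om 1 b)
    = (\<Sum>j<2. (of_int 1 gchoose j) *s prd (prd om (int j) a) (1 + n - int j) b)"
  proof (rule commutator)
    fix j :: nat assume "j \<ge> 2"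
    then have "1 choose j = 0"
      by (intro binomial_eq_0) simp
    then have "(of_int 1 gchoose j :: complex) = 0"
      by (metis binomial_gbinomial of_int_1 of_nat_0 of_nat_1)
    then show "(of_int 1 gchoose j) *s prd (prd om (int j) a) (1 + n - int j) b = 0" by simp
  qed
  also have "\<dots> = prd (prd om 0 a) (n + 1) b + prd (prd om 1 a) n b"
    by (simp add: numeral_2_eq_2 add.commute)
  also have "\<dots> = (of_nat h - of_int n - 1) *s prd a n b"
    using assms(1) by (simp add: translation wt_def L_def scale_left_diff_distrib scale_left_distrib)
  finally show ?thesis
    using assms(2) by (simp add: wt_def L_def algebra_simps)
qed

lemma prd_wt:
  assumes "a \<in> wt h" "b \<in> wt k" "int h + int k - n - 1 = int l"
  shows "prd a n b \<in> wt l"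
  using L0_prd[OF assms(1,2), of n] assms(3) by (simp add: wt_def)

lemma prd_wt_neg:
  assumes "a \<in> wt h" "b \<in> wt k" "int h + int k - n - 1 < 0"
  shows "prd a n b = 0"
proof (rule eigenvalue_nat[OF L0_prd[OF assms(1,2)]])
  show "(of_int (int h + int k - n - 1) :: complex) \<notin> \<nat>"
  proof
    assume "(of_int (int h + int k - n - 1) :: complex) \<in> \<nat>"
    then obtain l where "(of_int (int h + int k - n - 1) :: complex) = of_nat l"
      by (auto elim: Nats_cases)
    then have "int h + int k - n - 1 = int l"
      by (metis of_int_eq_iff of_int_of_nat_eq)
    then show False using assms(3) by simp
  qed
qed

lemma om_griess: "om \<in> griess"
  using L_comm[of 0 "-2" vac] by (simp add: griess_def wt_def L_om L_vac)

end

section \<open>The Griess algebra\<close>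

context vertex_algebra
begin

text \<open>
  The shifted index is chosen such that $a[m]=a_{(m+1)}$ lowers weights by \<open>m\<close> when \<open>a\<close> has weight 2, just
  as $L_m=\omega[m]$ does. The Griess product becomes \<open>mode a 0 b\<close>.
\<close>

definition mode :: "'v \<Rightarrow> int \<Rightarrow> 'v \<Rightarrow> 'v"
  where "mode a m v = prd a (m + 1) v"

lemma mode_simps [simp]:
  "mode (a + a') n b = mode a n b + mode a' n b" "mode (k *s a) n b = k *s mode a n b"
  "mode 0 n b = 0" "mode (a - a') n b = mode a n b - mode a' n b"
  "mode a n (b + b') = mode a n b + mode a n b'" "mode a n (k *s b) = k *s mode a n b"
  "mode a n 0 = 0" "mode a n (b - b') = mode a n b - mode a n b'"
  by (simp_all add: mode_def)

lemma mode_sum: "mode (sum f A) n b = (\<Sum>x\<in>A. mode (f x) n b)" "mode a n (sum f A) = (\<Sum>x\<in>A. mode a n (f x))"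
  by (simp_all add: mode_def prd_sum_left prd_sum_right)

lemma mode_vac [simp]: "n \<ge> - 1 \<Longrightarrow> mode a n vac = 0" "mode a (- 2) vac = a"
  by (simp_all add: mode_def vac_right_nonneg vac_right)

end

locale griess_voa = vertex_operator_algebra scale prd vac om c
  for scale :: "complex \<Rightarrow> 'v::ab_group_add \<Rightarrow> 'v" (infixr "*s" 75)
    and prd :: "'v \<Rightarrow> int \<Rightarrow> 'v \<Rightarrow> 'v" and vac om :: 'v and c :: complex +
  assumes wt_0: "wt 0 = span {vac}" and wt_1: "wt 1 = {0}"
    and nondegenerate: form_nondegenerate
begin

lemma L_eq_mode: "L m = mode om m"
  by (auto simp: L_def mode_def)

lemma wt_0_vac: "v \<in> wt 0 \<Longrightarrow> \<exists>k. v = k *s vac"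
  unfolding wt_0 span_singleton by auto

lemma mode_griess_neg: "a \<in> griess \<Longrightarrow> b \<in> griess \<Longrightarrow> n > 2 \<Longrightarrow> mode a n b = 0"
  unfolding griess_def mode_def using prd_wt_neg[of a 2 b 2 "n + 1"] by simp

lemma mode_griess_1: "a \<in> griess \<Longrightarrow> b \<in> griess \<Longrightarrow> mode a 1 b = 0"
  unfolding griess_def mode_def using prd_wt[of a 2 b 2 2 1] wt_1 by auto

lemma mode_griess_wt: "a \<in> griess \<Longrightarrow> b \<in> griess \<Longrightarrow> n = 2 - int l \<Longrightarrow> mode a n b \<in> wt l"
  unfolding griess_def mode_def using prd_wt[of a 2 b 2 "n + 1" l] by simp

lemma mode_griess_0: "a \<in> griess \<Longrightarrow> b \<in> griess \<Longrightarrow> mode a 0 b \<in> griess"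
  using mode_griess_wt[of a b 0 2] by (simp add: griess_def)

lemma formI: "prd a 3 b = k *s vac \<Longrightarrow> form a b = k"
  unfolding form_def by (rule the_equality) (auto simp: vac_coeff_eq vac_nonzero)

lemma mode_griess_2:
  assumes "a \<in> griess" "b \<in> griess"
  shows "mode a 2 b = form a b *s vac"
proof -
  obtain k where "mode a 2 b = k *s vac"
    using wt_0_vac[OF mode_griess_wt[OF assms, of 2 0]] by auto
  then show ?thesis using formI[of a b k] by (simp add: mode_def)
qed

lemma form_scale:
  assumes "a \<in> griess" "e \<in> griess"
  shows "form (k *s a) e = k * form a e" "form e (k *s a) = k * form e a"
  using mode_griess_2[OF assms] mode_griess_2[OF assms(2,1)] by (auto intro!: formI simp: mode_def)

lemma form_add_diff:
  assumes "a \<in> griess" "b \<in> griess" "e \<in> griess"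
  shows "form (a + b) e = form a e + form b e" "form e (a + b) = form e a + form e b"
    "form (a - b) e = form a e - form b e" "form e (a - b) = form e a - form e b"
  using mode_griess_2[OF assms(1,3)] mode_griess_2[OF assms(2,3)]
    mode_griess_2[OF assms(3,1)] mode_griess_2[OF assms(3,2)]
  by (auto intro!: formI simp: mode_def scale_left_distrib scale_left_diff_distrib)

lemmas form_linear = form_scale form_add_diff

lemma form_0 [simp]: "form 0 a = 0" "form a 0 = 0"
  by (auto intro!: formI)

lemma form_sum:
  assumes "\<And>i. i \<in> I \<Longrightarrow> f i \<in> griess" "e \<in> griess"
  shows "form (\<Sum>i\<in>I. r i *s f i) e = (\<Sum>i\<in>I. r i * form (f i) e)"
    "form e (\<Sum>i\<in>I. r i *s f i) = (\<Sum>i\<in>I. r i * form e (f i))"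
  using mode_griess_2[OF assms(1,2)] mode_griess_2[OF assms(2,1)]
  by (auto intro!: formI simp: mode_def prd_sum_left prd_sum_right scale_sum_left)

lemma griess_commutator:
  assumes "a \<in> griess" "b \<in> griess"
  shows "mode a m (mode b n x) - mode b n (mode a m x) =
    prd (prd a 0 b) (m + n + 2) x + of_int (m + 1) *s mode (mode a 0 b) (m + n) x
    + (if m + n = 0 then of_int (m ^ 3 - m) / 6 * form a b else 0) *s x"
proof -
  have g3: "(of_int (m + 1) gchoose Suc (Suc (Suc 0)) :: complex) = of_int (m ^ 3 - m) / 6"
    by (simp add: gbinomial_prod_rev algebra_simps power3_eq_cube)
  have "mode a m (mode b n x) - mode b n (mode a m x) =
    (\<Sum>j<4. (of_int (m + 1) gchoose j) *s prd (prd a (int j) b) ((m + 1) + (n + 1) - int j) x)"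
    unfolding mode_def
  proof (rule commutator)
    fix j :: nat assume "j \<ge> 4"
    then have "prd a (int j) b = 0"
      using mode_griess_neg[OF assms, of "int j - 1"] by (simp add: mode_def)
    then show "(of_int (m + 1) gchoose j) *s prd (prd a (int j) b) (m + 1 + (n + 1) - int j) x = 0"
      by simp
  qed
  also have "\<dots> = prd (prd a 0 b) (m + n + 2) x + of_int (m + 1) *s mode (mode a 0 b) (m + n) x
    + (of_int (m + 1) gchoose Suc (Suc (Suc 0))) *s prd (form a b *s vac) (m + n - 1) x"
    using mode_griess_1[OF assms] mode_griess_2[OF assms]
    by (simp add: numeral_eq_Suc mode_def algebra_simps)
  finally show ?thesis
    unfolding g3 by (auto simp: vac_left)
qed

text \<open>
  The bracket $[a[m],b[n]]$ depends on \<open>m\<close> and \<open>n\<close> separately only through the Griess product and the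
  form, because $(a_{(0)}b)_{(m+n+2)}$ is the same for all \<open>m\<close> with \<open>m + n\<close> fixed. Comparing with
  \<open>m = 0\<close> eliminates this term, which involves weight 3 vectors, so that everything below
  can be computed inside the Griess algebra.
\<close>

lemma commutator_shift:
  assumes "a \<in> griess" "b \<in> griess"
  shows "mode a m (mode b n x) - mode b n (mode a m x) =
    mode a 0 (mode b (m + n) x) - mode b (m + n) (mode a 0 x) + of_int m *s mode (mode a 0 b) (m + n) x
    + (if m + n = 0 then of_int (m ^ 3 - m) / 6 * form a b else 0) *s x"
  using griess_commutator[OF assms, of m n x] griess_commutator[OF assms, of 0 "m + n" x]
  by (simp add: scale_left_distrib algebra_simps)

text \<open>
  Swapping the two factors changes the sign of the bracket; for equal vectors, comparing both
  orders by means of the preceding lemma determines it.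
\<close>

lemma self_commutator:
  assumes "a \<in> griess"
  shows "mode a m (mode a 0 x) - mode a 0 (mode a m x) = (of_int m / 2) *s mode (mode a 0 a) m x"
proof -
  let ?C = "mode a m (mode a 0 x) - mode a 0 (mode a m x)"
  have "?C + ?C = of_int m *s mode (mode a 0 a) m x"
    using commutator_shift[OF assms assms, of m 0 x] by (auto simp: algebra_simps)
  then have "(1 / 2) *s (?C + ?C) = (of_int m / 2) *s mode (mode a 0 a) m x" by simp
  then show ?thesis
    by (simp only: scale_right_distrib scale_left_distrib[symmetric]) simp
qed

text \<open>
  Skew symmetry comes from the commutator of $b_{(-1)}$ and $a_{(n)}$ on the vacuum, where
  $b_{(-1)}\mathbf 1=b$ and $a_{(n)}\mathbf 1=0$.
\<close>

lemma skew_symmetry_vac: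
  assumes "a \<in> griess" "b \<in> griess" "n \<ge> 0"
  shows "prd a n b = - (\<Sum>j<4. (- 1) ^ j *s prd (prd b (int j) a) (- 1 + n - int j) vac)"
proof -
  have "prd b (- 1) (prd a n vac) - prd a n (prd b (- 1) vac) =
    (\<Sum>j<4. (of_int (- 1) gchoose j) *s prd (prd b (int j) a) (- 1 + n - int j) vac)"
  proof (rule commutator)
    fix j :: nat assume "j \<ge> 4"
    then have "prd b (int j) a = 0"
      using mode_griess_neg[OF assms(2,1), of "int j - 1"] by (simp add: mode_def)
    then show "(of_int (- 1) gchoose j) *s prd (prd b (int j) a) (- 1 + n - int j) vac = 0"
      by simp
  qed
  also have "prd b (- 1) (prd a n vac) - prd a n (prd b (- 1) vac) = - prd a n b"
    using assms(3) by (simp add: vac_right vac_right_nonneg)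
  also have "(gchoose) (of_int (- 1)) = (\<lambda>j. (- 1 :: complex) ^ j)"
    using gbinomial_minus[of "1 :: complex"] by (auto simp: fun_eq_iff simp flip: binomial_gbinomial)
  finally show ?thesis
    by (metis minus_minus)
qed

lemma form_commute: "a \<in> griess \<Longrightarrow> b \<in> griess \<Longrightarrow> form a b = form b a"
  using skew_symmetry_vac[of a b 3] mode_griess_2[of b a]
  by (intro formI) (simp add: numeral_eq_Suc vac_right_nonneg vac_right mode_def)

lemma griess_commute:
  assumes "a \<in> griess" "b \<in> griess"
  shows "mode a 0 b = mode b 0 a"
  using skew_symmetry_vac[OF assms, of 1] mode_griess_2[OF assms(2,1)] mode_griess_1[OF assms(2,1)]
  by (simp add: numeral_eq_Suc vac_right_nonneg vac_right vac_left mode_def)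

lemma pairing_aux:
  assumes "u \<in> griess" "x \<in> griess" "y \<in> griess" "q \<ge> 2"
  shows "mode u q (mode x (2 - q) y)
    = (of_int q * form (mode u 0 x) y - form x (mode u 0 y)) *s vac"
proof -
  have 0: "mode x (2 - q) (mode u q y) = 0"
    using mode_griess_neg[OF assms(1,3), of q] mode_griess_2[OF assms(1,3)] assms(4)
    by (cases "q = 2") auto
  have "mode u q (mode x (2 - q) y) = - mode x 2 (mode u 0 y) + of_int q *s mode (mode u 0 x) 2 y"
    using commutator_shift[OF assms(1,2), of q "2 - q" y]
    by (simp add: 0 mode_griess_2[OF assms(2,3)])
  then show ?thesis
    by (simp add: mode_griess_2 mode_griess_0 assms scale_left_diff_distrib)
qed

text \<open>
  By the case \<open>q = 2\<close> of the preceding lemma, twice each of the three numbers $(ux|y)$, $(xy|u)$,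
  $(yu|x)$ is the sum of the other two; hence all three agree.
\<close>

lemma form_invariant:
  assumes "u \<in> griess" "x \<in> griess" "y \<in> griess"
  shows "form (mode u 0 x) y = form u (mode x 0 y)"
proof -
  have *: "form u (mode x 0 y) + form x (mode u 0 y) = 2 * form (mode u 0 x) y"
    if "u \<in> griess" "x \<in> griess" "y \<in> griess" for u x y
  proof -
    have "form u (mode x 0 y) = 2 * form (mode u 0 x) y - form x (mode u 0 y)"
      by (rule formI) (use pairing_aux[OF that, of 2] in \<open>simp add: mode_def\<close>)
    then show ?thesis by simp
  qed
  have **: "p = q" if "q + r = 2 * p" "p + r = 2 * q" for p q r :: complex
  proof -
    have "3 * (p - q) = (2 * p - 2 * q) - ((q + r) - (p + r))"
      by (simp add: algebra_simps)
    then show ?thesis unfolding that by simp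
  qed
  show ?thesis
  proof (rule **)
    show "form u (mode x 0 y) + form x (mode u 0 y) = 2 * form (mode u 0 x) y"
      by (rule *[OF assms])
    show "form (mode u 0 x) y + form x (mode u 0 y) = 2 * form u (mode x 0 y)"
      using *[OF assms(3,2,1)] assms griess_commute[of u x] griess_commute[of x y]
        griess_commute[of y u] form_commute[of u "mode x 0 y"] form_commute[of y "mode u 0 x"]
      by (simp add: mode_griess_0)
  qed
qed

lemma pairing:
  assumes "u \<in> griess" "x \<in> griess" "y \<in> griess" "q \<ge> 2"
  shows "mode u q (mode x (2 - q) y) = (of_int (q - 1) * form (mode u 0 x) y) *s vac"
  using pairing_aux[OF assms] form_invariant[of x u y] griess_commute[of u x] assms
  by (simp add: algebra_simps)

lemma L_mode_commute:
  assumes "x \<in> griess"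
  shows "L m (mode x n v) = mode x n (L m v) + of_int (m - n) *s mode x (m + n) v
    + (if m + n = 0 then of_int (m ^ 3 - m) / 6 * form om x else 0) *s v"
proof -
  have "mode om 0 x = 2 *s x"
    using assms by (simp add: griess_def wt_def flip: L_eq_mode)
  then have "mode om m (mode x n v) - mode x n (mode om m v) = - (of_int (m + n + 2) *s mode x (m + n) v)
      + of_int (m + 1) *s (2 *s mode x (m + n) v)
      + (if m + n = 0 then of_int (m ^ 3 - m) / 6 * form om x else 0) *s v"
    using griess_commutator[OF om_griess assms, of m n v]
    by (simp add: translation) (simp add: mode_def algebra_simps)
  also have "- (of_int (m + n + 2) *s mode x (m + n) v) + of_int (m + 1) *s (2 *s mode x (m + n) v)
     = of_int (m - n) *s mode x (m + n) v"
    by (simp add: algebra_simps flip: scale_left_distrib scale_left_diff_distrib scale_minus_left)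
  finally show ?thesis
    by (simp add: L_eq_mode algebra_simps)
qed

lemma L_griess:
  assumes "x \<in> griess" "m \<ge> 1"
  shows "L m x = (if m = 2 then form om x else 0) *s vac"
proof -
  consider "m = 1" | "m = 2" | "m > 2" using assms(2) by force
  then show ?thesis
    by cases (use assms om_griess mode_griess_1 mode_griess_2 mode_griess_neg in \<open>auto simp: L_eq_mode\<close>)
qed

lemma form_om_om: "form om om = c / 2"
  using L_comm[of 2 "-2" vac] L_griess[OF om_griess, of 2]
  by (simp add: L_om L_vac vac_coeff_eq vac_nonzero)

end

section \<open>A spanning set of the Virasoro submodule\<close>

text \<open>
  The partitions of \<open>n\<close> into parts between 2 and \<open>k\<close>, each part entered with a minus sign because it
  is the index of a Virasoro mode applied to the vacuum.
\<close>

function partitions :: "nat \<Rightarrow> nat \<Rightarrow> int list list"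
  where "partitions 0 k = [[]]"
  | "partitions (Suc n) k =
      concat (map (\<lambda>j. map ((#) (- int j)) (partitions (Suc n - j) j)) [2..<Suc (min k (Suc n))])"
  by pat_completeness auto
termination by (relation "measure fst") auto

lemma partitions_values:
  "partitions 2 2 = [[-2]]" "partitions 4 4 = [[-2, -2], [-4]]"
  "partitions 6 6 = [[-2, -2, -2], [-3, -3], [-4, -2], [-6]]"
  "partitions 8 8 = [[-2, -2, -2, -2], [-3, -3, -2], [-4, -2, -2], [-4, -4], [-5, -3], [-6, -2], [-8]]"
  by code_simp+

context griess_voa
begin

definition word :: "int list \<Rightarrow> 'v"
  where "word ws = foldr L ws vac"

definition pbw :: "int list \<Rightarrow> bool"
  where "pbw ws \<longleftrightarrow> sorted ws \<and> (\<forall>m\<in>set ws. m \<le> - 2)"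

definition pbw_span :: "nat \<Rightarrow> 'v set"
  where "pbw_span k = span {word ws |ws. pbw ws \<and> length ws \<le> k}"

lemma word_simps [simp]: "word [] = vac" "word (m # ws) = L m (word ws)"
  by (simp_all add: word_def)

lemma pbw_span_mono: "j \<le> k \<Longrightarrow> pbw_span j \<subseteq> pbw_span k"
  unfolding pbw_span_def by (rule span_mono) auto

lemma subspace_pbw_span: "subspace (pbw_span k)"
  by (simp add: pbw_span_def)

lemma pbw_word_in_span: "pbw ws \<Longrightarrow> length ws \<le> k \<Longrightarrow> word ws \<in> pbw_span k"
  unfolding pbw_span_def by (rule span_base) auto

lemma L_image_span:
  assumes "\<And>x. x \<in> X \<Longrightarrow> L m x \<in> W" "subspace W" "x \<in> span X"
  shows "L m x \<in> W"
  using assms(3)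
  by (induction rule: span_induct_alt)
    (auto simp: assms(1) subspace_0[OF assms(2)] intro!: subspace_add[OF assms(2)] subspace_scale[OF assms(2)])

lemma pbw_insort: "pbw ws \<Longrightarrow> m \<le> - 2 \<Longrightarrow> pbw (insort m ws)"
  by (auto simp: pbw_def set_insort_key sorted_insort)

text \<open>
  Poincare-Birkhoff-Witt reordering: commuting $L_m$ past the smaller indices sorts it into the word,
  at the cost of shorter words only. If \<open>m\<close> is at least \<open>-1\<close>, then $L_m$ reaches the vacuum and kills
  it, so that the leading term disappears. The induction is on the length and not on the list,
  since the shorter words that arise are not subwords of the given one.
\<close>

lemma L_word:
  assumes "pbw ws"
  shows "L m (word ws) - (if m \<le> - 2 then word (insort m ws) else 0) \<in> pbw_span (length ws)"
  using assms
proof (induction "length ws" arbitrary: ws m rule: less_induct)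
  case less
  have step: "L m x \<in> pbw_span (Suc k)" if "k < length ws" "x \<in> pbw_span k" for m x k
  proof (rule L_image_span[OF _ subspace_pbw_span that(2)[unfolded pbw_span_def]])
    fix x assume "x \<in> {word ws |ws. pbw ws \<and> length ws \<le> k}"
    then obtain us where us: "x = word us" "pbw us" "length us \<le> k" by auto
    then have "L m x - (if m \<le> - 2 then word (insort m us) else 0) \<in> pbw_span (length us)"
      using less.hyps[of us m] that(1) by simp
    moreover have "(if m \<le> - 2 then word (insort m us) else 0) \<in> pbw_span (Suc k)"
      using us pbw_insort[of us m] pbw_word_in_span[of "insort m us" "Suc k"]
      by (auto simp: subspace_0[OF subspace_pbw_span])
    ultimately have "(L m x - (if m \<le> - 2 then word (insort m us) else 0))
        + (if m \<le> - 2 then word (insort m us) else 0) \<in> pbw_span (Suc k)"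
      using pbw_span_mono[of "length us" "Suc k"] us(3) by (intro subspace_add[OF subspace_pbw_span]) auto
    then show "L m x \<in> pbw_span (Suc k)" by simp
  qed
  show ?case
  proof (cases ws)
    case Nil
    then show ?thesis
      by (simp add: L_vac subspace_0[OF subspace_pbw_span])
  next
    case (Cons n us)
    have gu: "pbw us" and n: "n \<le> - 2"
      using less.prems by (auto simp: pbw_def Cons)
    show ?thesis
    proof (cases "m \<le> n")
      case True
      then show ?thesis
        using n by (simp add: Cons subspace_0[OF subspace_pbw_span])
    next
      case False
      let ?k = "length us"
      let ?i = "if m \<le> - 2 then word (insort m us) else 0"
      define z where "z = L m (word us) - ?i"
      have z: "z \<in> pbw_span ?k"
        unfolding z_def using less.hyps[of us m] gu by (simp add: Cons)
      have u: "word us \<in> pbw_span ?k"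
        by (rule pbw_word_in_span) (use gu in auto)
      have "L m (word ws) - (if m \<le> - 2 then word (insort m ws) else 0) =
          L n z + of_int (m - n) *s L (m + n) (word us)
            + (if m + n = 0 then of_int (m ^ 3 - m) / 12 * c else 0) *s word us"
        using False by (auto simp: Cons L_comm[of m n] z_def)
      also have "\<dots> \<in> pbw_span (Suc ?k)"
        using z u pbw_span_mono[of ?k "Suc ?k"]
        by (intro subspace_add[OF subspace_pbw_span] subspace_scale[OF subspace_pbw_span] step) (auto simp: Cons)
      finally show ?thesis by (simp add: Cons)
    qed
  qed
qed

lemma vir_sub_span: "vir_sub \<subseteq> span {word ws |ws. pbw ws}"
proof -
  let ?G = "{word ws |ws. pbw ws}"
  have sub: "pbw_span k \<subseteq> span ?G" for k
    unfolding pbw_span_def by (rule span_mono) auto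
  have ins: "(if m \<le> - 2 then word (insort m ws) else 0) \<in> span ?G" if "pbw ws" for m ws
    using pbw_insort[OF that, of m] by (auto intro: span_base simp: span_zero)
  have "L m x \<in> span ?G" if "x \<in> ?G" for m x
  proof -
    from that obtain ws where ws: "x = word ws" "pbw ws" by auto
    have "(L m x - (if m \<le> - 2 then word (insort m ws) else 0))
        + (if m \<le> - 2 then word (insort m ws) else 0) \<in> span ?G"
      using L_word[OF ws(2), of m] ws(1) sub[of "length ws"]
      by (intro span_add ins ws(2)) auto
    then show ?thesis by simp
  qed
  then have "L m x \<in> span ?G" if "x \<in> span ?G" for m x
    by (rule L_image_span[OF _ _ that]) auto
  moreover have "vac \<in> span ?G"
    by (rule span_base) (auto simp: pbw_def intro!: exI[of _ "[]"])
  ultimately show ?thesis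
    unfolding vir_sub_def by (intro Inter_lower) auto
qed

lemma word_eigenvector: "L 0 (word ws) = - of_int (sum_list ws) *s word ws"
proof (induction ws)
  case (Cons m ws)
  have "L 0 (L m (word ws)) = L m (L 0 (word ws)) + of_int (- m) *s L m (word ws)"
    using L_comm[of 0 m "word ws"] by simp
  then show ?case
    unfolding Cons.IH L_scale word_simps
    by (simp add: algebra_simps flip: scale_left_distrib scale_left_diff_distrib scale_minus_left)
qed (simp add: L_vac)

lemma pbw_partitions:
  assumes "pbw ws" "sum_list ws = - int n" "\<And>m. m \<in> set ws \<Longrightarrow> m \<ge> - int k"
  shows "ws \<in> set (partitions n k)"
  using assms
proof (induction ws arbitrary: n k)
  case (Cons m ws)
  define j where "j = nat (- m)"
  have m: "m = - int j" "j \<ge> 2" "j \<le> k"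
    using Cons.prems(1) Cons.prems(3)[of m] by (auto simp: j_def pbw_def)
  have neg: "sum_list vs \<le> 0" if "\<forall>x\<in>set vs. x \<le> (- 2 :: int)" for vs
    using that by (induction vs) auto
  have "sum_list ws \<le> 0"
    using Cons.prems(1) by (intro neg) (auto simp: pbw_def)
  then have n: "j \<le> n" using Cons.prems(2) m by auto
  have "ws \<in> set (partitions (n - j) j)"
    using Cons.prems m n by (intro Cons.IH) (auto simp: pbw_def)
  then have "m # ws \<in> (#) (- int j) ` set (partitions (n - j) j)"
    by (simp add: m)
  moreover have "j \<in> set [2..<Suc (min k n)]"
    using m n by (auto simp del: upt_Suc)
  ultimately have "m # ws \<in> (\<Union>j\<in>set [2..<Suc (min k n)]. (#) (- int j) ` set (partitions (n - j) j))"
    by (rule UN_I[rotated])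
  then show ?case
    using m n by (cases n) (simp_all del: upt_Suc)
qed auto

lemma vir_sub_wt:
  assumes "v \<in> vir_sub" "v \<in> wt n"
  shows "v \<in> span (word ` set (partitions n n))"
proof -
  let ?G = "{word ws |ws. pbw ws}"
  have G: "pbw ws \<Longrightarrow> word ws \<in> wt (nat (- sum_list ws)) \<and> sum_list ws \<le> 0" for ws
  proof -
    assume "pbw ws"
    then have "sum_list ws \<le> 0"
      by (intro sum_list_nonpos) (auto simp: pbw_def)
    then show ?thesis by (simp add: wt_def word_eigenvector)
  qed
  have "?G \<subseteq> (\<Union>k. ?G \<inter> wt k)"
    using G by blast
  then have "v \<in> span (\<Union>k. ?G \<inter> wt k)"
    using vir_sub_span assms(1) span_mono by blast
  moreover have "L 0 v = of_nat n *s v"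
    using assms(2) by (simp add: wt_def)
  ultimately have v: "v \<in> span (?G \<inter> wt n)"
    using eigenvector_in_span by blast
  have "?G \<inter> wt n \<subseteq> insert 0 (word ` set (partitions n n))"
  proof
    fix x assume "x \<in> ?G \<inter> wt n"
    then obtain ws where ws: "x = word ws" "pbw ws" "L 0 (word ws) = of_nat n *s word ws"
      by (auto simp: wt_def)
    show "x \<in> insert 0 (word ` set (partitions n n))"
    proof (cases "word ws = 0")
      case False
      then have "- of_int (sum_list ws) = (of_int (int n) :: complex)"
        using ws(3) unfolding word_eigenvector scale_cancel_right by simp
      then have s: "sum_list ws = - int n"
        by (metis add.inverse_inverse of_int_eq_iff of_int_minus)
      have "m \<ge> - int n" if "m \<in> set ws" for m
      proof -
        have "sum_list (remove1 m ws) \<le> 0"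
          using ws(2) by (intro sum_list_nonpos) (use set_remove1_subset[of m ws] in \<open>force simp: pbw_def\<close>)
        moreover have "sum_list ws = m + sum_list (remove1 m ws)"
          using that by (rule sum_list_map_remove1[where f = "\<lambda>x. x", simplified])
        ultimately show ?thesis using s by simp
      qed
      then have "ws \<in> set (partitions n n)"
        using pbw_partitions[OF ws(2) s] by blast
      then show ?thesis using ws(1) by simp
    qed (simp add: ws)
  qed
  then show ?thesis
    using v span_mono[of "?G \<inter> wt n" "insert 0 (word ` set (partitions n n))"] by auto
qed

end

section \<open>Dual bases and Casimir vectors\<close>

context griess_voa
begin

definition dual_basis :: "'v set \<Rightarrow> ('v \<Rightarrow> 'v) \<Rightarrow> bool"
  where "dual_basis S du \<longleftrightarrow> finite S \<and> S \<subseteq> griess \<and> span S = griess \<and> du ` S \<subseteq> griess \<and>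
    (\<forall>s\<in>S. \<forall>t\<in>S. form (du s) t = (if s = t then 1 else 0))"

lemma nondegenerateD: "a \<in> griess \<Longrightarrow> (\<And>b. b \<in> griess \<Longrightarrow> form a b = 0) \<Longrightarrow> a = 0"
  using nondegenerate unfolding form_nondegenerate_def by blast

lemma span_griess_eq_0:
  assumes "S \<subseteq> griess" "a \<in> griess" "\<And>s. s \<in> S \<Longrightarrow> form a s = 0" "b \<in> span S"
  shows "form a b = 0"
proof -
  have "b \<in> griess \<and> form a b = 0"
    using assms(4)
  proof (induction rule: span_induct_alt)
    case (step r x y)
    then have "x \<in> griess" using assms(1) by auto
    moreover from this have "r *s x \<in> griess" by (rule subspace_scale[OF subspace_griess])
    ultimately show ?case
      using step assms(2,3) by (auto simp: form_linear subspace_add[OF subspace_griess])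
  qed (simp add: subspace_0[OF subspace_griess])
  then show ?thesis by simp
qed

text \<open>
  For a basis \<open>S\<close>, the map $a\mapsto\sum_{s\in S}(a|s)s$ is injective on the Griess algebra by
  nondegeneracy, hence surjective by finite dimension; the preimages of the elements of \<open>S\<close> form the
  dual basis.
\<close>

lemma dual_basis_exists: "\<exists>S du. dual_basis S du \<and> card S = dim griess"
proof -
  obtain S where S: "S \<subseteq> griess" "independent S" "griess \<subseteq> span S" "card S = dim griess"
    using basis_exists by blast
  have sp: "span S = griess"
    using S(1,3) span_minimal[OF _ subspace_griess] by blast
  obtain F where "finite F" "griess \<subseteq> span F"
    using finite_dim[of 2] by (auto simp: griess_def wt_def L_def)
  then have fin: "finite S"
    using independent_span_bound[of F S] S by blast
  interpret vector_space_pair scale scale ..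
  define T where "T a = (\<Sum>s\<in>S. form a s *s s)" for a
  define f where "f = construct S T"
  have f: "Vector_Spaces.linear scale scale f" "\<And>s. s \<in> S \<Longrightarrow> f s = T s"
    using linear_construct[OF S(2)] construct_basis[OF S(2)] by (auto simp: f_def)
  interpret f: Vector_Spaces.linear scale scale f by (rule f(1))
  have fT: "f a = T a" if "a \<in> griess" for a
  proof -
    have "a \<in> griess \<and> f a = T a"
      using that unfolding sp[symmetric]
    proof (induction rule: span_induct_alt)
      case base
      show ?case by (simp add: T_def span_zero f.zero)
    next
      case (step r x y)
      have g: "x \<in> griess" "y \<in> griess" "r *s x \<in> griess"
        using step S(1) by (auto simp: sp intro: subspace_scale[OF subspace_griess])
      have "T (r *s x + y) = r *s T x + T y"
        unfolding T_def scale_sum_right sum.distrib[symmetric]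
        by (rule sum.cong) (use g S(1) in \<open>auto simp: form_linear subsetD scale_left_distrib\<close>)
      then show ?case
        using step g f(2) by (simp add: f.add f.scale sp subspace_add[OF subspace_griess])
    qed
    then show ?thesis by simp
  qed
  have "inj_on f (span S)"
  proof (rule f.inj_on_iff_eq_0[THEN iffD2, OF subspace_span], intro ballI impI)
    fix a assume a: "a \<in> span S" "f a = 0"
    then have "T a = 0" using fT sp by simp
    then have "form a s = 0" if "s \<in> S" for s
      using independentD[OF S(2) fin order_refl, of "form a" s] that by (simp add: T_def)
    then show "a = 0"
      using nondegenerateD[of a] span_griess_eq_0[OF S(1), of a] a(1) by (auto simp: sp)
  qed
  then have ind: "independent (f ` S)" and inj: "inj_on f S"
    using f.independent_injective_image[OF S(2)] inj_on_subset[OF _ span_superset] by auto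
  have sub: "f ` S \<subseteq> span S"
  proof (rule image_subsetI)
    fix x assume "x \<in> S"
    then show "f x \<in> span S"
      using f(2) unfolding T_def by (auto intro: span_sum span_scale span_base)
  qed
  have "S \<subseteq> span (f ` S)"
  proof
    fix s assume s: "s \<in> S"
    show "s \<in> span (f ` S)"
    proof (rule ccontr)
      assume n: "s \<notin> span (f ` S)"
      then have "independent (insert s (f ` S))"
        by (rule independent_insertI[OF _ ind])
      moreover have "insert s (f ` S) \<subseteq> span S"
        using sub s by (auto intro: span_base)
      ultimately have "card (insert s (f ` S)) \<le> card S"
        using independent_span_bound[OF fin] by blast
      moreover have "s \<notin> f ` S" using n span_base by blast
      ultimately show False
        using fin by (simp add: card_image[OF inj])
    qed
  qed
  also have "\<dots> = f ` griess"
    by (simp add: f.span_image sp)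
  finally have "\<exists>a\<in>griess. T a = s" if "s \<in> S" for s
    using that fT by (force simp: image_iff)
  then obtain du where du: "\<And>s. s \<in> S \<Longrightarrow> du s \<in> griess" "\<And>s. s \<in> S \<Longrightarrow> T (du s) = s"
    by metis
  have "form (du s) t = (if s = t then 1 else 0)" if "s \<in> S" "t \<in> S" for s t
  proof -
    have "(\<Sum>t\<in>S. (form (du s) t - (if s = t then 1 else 0)) *s t) = T (du s) - (\<Sum>t\<in>S. (if s = t then 1 else 0) *s t)"
      by (simp add: T_def scale_left_diff_distrib sum_subtractf)
    also have "(\<Sum>t\<in>S. (if s = t then 1 else 0) *s t) = (\<Sum>t\<in>S. if s = t then s else 0)"
      by (rule sum.cong) auto
    also have "\<dots> = s" using fin that(1) by simp
    finally have "(\<Sum>t\<in>S. (form (du s) t - (if s = t then 1 else 0)) *s t) = 0"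
      using du that by simp
    then show ?thesis
      using independentD[OF S(2) fin order_refl _ that(2)] by fastforce
  qed
  then have "dual_basis S du"
    using fin S(1) sp du by (auto simp: dual_basis_def)
  then show ?thesis using S(4) by blast
qed

end

locale griess_casimir = griess_voa scale prd vac om c
  for scale :: "complex \<Rightarrow> 'v::ab_group_add \<Rightarrow> 'v" (infixr "*s" 75)
    and prd :: "'v \<Rightarrow> int \<Rightarrow> 'v \<Rightarrow> 'v" and vac om :: 'v and c :: complex +
  fixes S :: "'v set" and du :: "'v \<Rightarrow> 'v"
  assumes dual: "dual_basis S du"
begin

lemma fin: "finite S" and S_griess: "s \<in> S \<Longrightarrow> s \<in> griess"
  and du_griess: "s \<in> S \<Longrightarrow> du s \<in> griess" and span_S: "span S = griess"
  and form_du: "s \<in> S \<Longrightarrow> t \<in> S \<Longrightarrow> form (du s) t = (if s = t then 1 else 0)"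
  using dual by (auto simp: dual_basis_def)

lemma sum_delta: "t \<in> S \<Longrightarrow> (\<Sum>s\<in>S. f s * (if s = t then 1 else 0)) = (f t :: complex)"
  using fin by (simp add: if_distrib[of "\<lambda>x. _ * x"] cong: if_cong)

lemma expand_dual:
  assumes "v \<in> griess"
  shows "(\<Sum>s\<in>S. form v s *s du s) = v"
proof -
  let ?w = "(\<Sum>s\<in>S. form v s *s du s)"
  have w: "?w \<in> griess"
    by (intro subspace_sum subspace_griess subspace_scale du_griess)
  have "form (?w - v) t = 0" if "t \<in> S" for t
  proof -
    have "form ?w t = (\<Sum>s\<in>S. form v s * form (du s) t)"
      using that by (simp add: form_sum du_griess S_griess)
    also have "\<dots> = form v t"
      using that by (simp add: form_du sum_delta cong: sum.cong)
    finally show ?thesis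
      using that w assms by (simp add: form_linear S_griess)
  qed
  then have "?w - v = 0"
    using span_griess_eq_0[of S "?w - v"] w assms S_griess
    by (intro nondegenerateD) (auto simp: span_S subspace_diff[OF subspace_griess])
  then show ?thesis by simp
qed

lemma expand_basis:
  assumes "v \<in> griess"
  shows "(\<Sum>s\<in>S. form (du s) v *s s) = v"
proof -
  let ?w = "(\<Sum>s\<in>S. form (du s) v *s s)"
  have w: "?w \<in> griess"
    by (intro subspace_sum subspace_griess subspace_scale S_griess)
  have 1: "form (?w - v) b = 0" if "b \<in> griess" for b
  proof -
    have "form ?w b = (\<Sum>s\<in>S. form (du s) v * form b s)"
      using that by (simp add: form_sum S_griess form_commute[of b])
    also have "\<dots> = form (\<Sum>s\<in>S. form b s *s du s) v"
      using assms by (simp add: form_sum du_griess mult.commute)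
    finally show ?thesis
      using that w assms by (simp add: form_linear expand_dual form_commute[of b])
  qed
  have "?w - v = 0"
    by (rule nondegenerateD[OF _ 1]) (use w assms in \<open>auto simp: subspace_diff[OF subspace_griess]\<close>)
  then show ?thesis by simp
qed

text \<open>
  The Casimir vectors $\kappa_n=\sum_s s^*_{(3-n)}s$ of weight \<open>n\<close>. They do not depend on the basis and
  are therefore fixed by all automorphisms.
\<close>

definition casimir :: "int \<Rightarrow> 'v"
  where "casimir n = (\<Sum>s\<in>S. mode (du s) (2 - n) s)"

lemma casimir_wt: "casimir (int n) \<in> wt n"
  unfolding casimir_def
  by (intro subspace_sum subspace_wt mode_griess_wt) (auto simp: S_griess du_griess)

lemma casimir_0: "casimir 0 = of_nat (card S) *s vac"
  by (simp add: casimir_def mode_griess_2 du_griess S_griess form_du sum_constant_scale)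

lemma casimir_1: "casimir 1 = 0"
  by (simp add: casimir_def mode_griess_1 du_griess S_griess)

text \<open>
  The positive Virasoro modes map Casimir vectors to multiples of Casimir vectors of smaller weight,
  plus known vectors. Iterating down to weight 0 yields numbers that depend only on \<open>c\<close> and on the
  dimension.
\<close>

lemma L_casimir:
  assumes "m \<ge> 1"
  shows "L m (casimir n) = of_int (m + n - 2) *s casimir (n - m)
    + (if m = n - 2 then of_int (m ^ 3 - m) / 6 else 0) *s om + (if m = 2 then L (2 - n) vac else 0)"
proof -
  have "L m (mode (du s) (2 - n) s) = of_int (m + n - 2) *s mode (du s) (2 - (n - m)) s
      + (if m = n - 2 then of_int (m ^ 3 - m) / 6 else 0) *s (form om (du s) *s s)
      + (if m = 2 then mode (form om s *s du s) (2 - n) vac else 0)" if "s \<in> S" for s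
    using L_mode_commute[OF du_griess[OF that], of m "2 - n" s] L_griess[OF S_griess[OF that] assms]
    by (auto simp: algebra_simps)
  then have "L m (casimir n) = of_int (m + n - 2) *s casimir (n - m)
      + (if m = n - 2 then of_int (m ^ 3 - m) / 6 else 0) *s (\<Sum>s\<in>S. form om (du s) *s s)
      + (if m = 2 then mode (\<Sum>s\<in>S. form om s *s du s) (2 - n) vac else 0)"
    by (simp add: casimir_def L_sum sum.distrib scale_sum_right mode_sum)
  also have "(\<Sum>s\<in>S. form om (du s) *s s) = om"
    using expand_basis[OF om_griess] om_griess by (simp add: form_commute du_griess)
  finally show ?thesis
    by (simp add: expand_dual om_griess L_eq_mode)
qed

text \<open>
  \<open>tr1 a\<close> is the trace of the multiplication by \<open>a\<close> on the Griess algebra, and \<open>tr2 a\<close>, by invariance of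
  the form, the trace of its square.
\<close>

definition tr1 :: "'v \<Rightarrow> complex"
  where "tr1 a = (\<Sum>s\<in>S. form (mode a 0 (du s)) s)"

definition tr2 :: "'v \<Rightarrow> complex"
  where "tr2 a = (\<Sum>s\<in>S. form (mode a 0 (du s)) (mode a 0 s))"

lemma tr1_casimir: "a \<in> griess \<Longrightarrow> tr1 a = form a (casimir 2)"
  using form_sum(2)[of S "\<lambda>s. mode (du s) 0 s" a "\<lambda>_. 1"]
  by (simp add: tr1_def casimir_def form_invariant du_griess S_griess mode_griess_0)

text \<open>
  All terms reduce to the two
  traces, because $[a[q],x[2-2q]]$ can be traded for $[a[0],x[2-q]]$ and \<open>pairing\<close> evaluates
  what remains. The terms with $(a|x)$ and $(a|y)$ occur only for \<open>q = 2\<close>.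
\<close>

lemma mode_mode_casimir:
  assumes a: "a \<in> griess" and q: "q \<ge> 2"
  shows "mode a q (mode a q (casimir (2 * q))) =
    (of_int (q * (q - 1)) / 2 * tr1 (mode a 0 a) + of_int ((q - 1)\<^sup>2) * tr2 a
     + (if q = 2 then 2 * form a a else 0)) *s vac"
proof -
  let ?aa = "mode a 0 a"
  have aa: "?aa \<in> griess" by (simp add: mode_griess_0 a)
  have summand: "mode a q (mode a q (mode x (2 - 2 * q) y)) =
      (of_int (q * (q - 1)) / 2 * form (mode ?aa 0 x) y
       + of_int ((q - 1)\<^sup>2) * form (mode a 0 x) (mode a 0 y)
       + (if q = 2 then 2 * form a x * form a y else 0)) *s vac"
    if x: "x \<in> griess" and y: "y \<in> griess" for x y
  proof -
    have ax: "mode a 0 x \<in> griess" and ay: "mode a 0 y \<in> griess" by (simp_all add: mode_griess_0 a x y)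
    let ?w = "mode x (2 - q) y"
    have w: "?w \<in> wt (nat q)"
      using mode_griess_wt[OF x y, of "2 - q" "nat q"] q by simp
    have "mode a q ?w \<in> wt 0"
      unfolding mode_def using prd_wt[of a 2 ?w "nat q" "q + 1" 0] a w q by (simp add: griess_def mode_def)
    then have 0: "mode a 0 (mode a q ?w) = 0"
      using wt_0_vac by fastforce
    have 1: "mode a q (mode a 0 ?w) = (of_int (q * (q - 1)) / 2 * form (mode ?aa 0 x) y) *s vac"
      using self_commutator[OF a, of q ?w] pairing[OF aa x y q] by (simp add: 0 mult.assoc)
    have 2: "mode a q (mode x (2 - q) (mode a 0 y)) = (of_int (q - 1) * form (mode a 0 x) (mode a 0 y)) *s vac"
      by (rule pairing[OF a x ay q])
    have 3: "mode a q (mode (mode a 0 x) (2 - q) y) = (of_int (q - 1) * form (mode a 0 x) (mode a 0 y)) *s vac"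
      using pairing[OF a ax y q] form_invariant[OF a ax y] form_invariant[of "mode a 0 x" a y]
        griess_commute[OF a ax] a ax y by simp
    have 4: "mode x (2 - 2 * q) (mode a q y) = (if q = 2 then form a y *s mode x (- 2) vac else 0)"
      using mode_griess_neg[OF a y] mode_griess_2[OF a y] q by auto
    have "mode a q (mode x (2 - 2 * q) y) = mode a 0 ?w - mode x (2 - q) (mode a 0 y)
        + of_int q *s mode (mode a 0 x) (2 - q) y
        + (if q = 2 then form a x *s y + form a y *s x else 0)"
      using commutator_shift[OF a x, of q "2 - 2 * q" y] 4 by (auto simp: algebra_simps)
    then have "mode a q (mode a q (mode x (2 - 2 * q) y)) =
        mode a q (mode a 0 ?w) - mode a q (mode x (2 - q) (mode a 0 y))
        + of_int q *s mode a q (mode (mode a 0 x) (2 - q) y)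
        + (if q = 2 then form a x *s mode a 2 y + form a y *s mode a 2 x else 0)"
      by auto
    also have "\<dots> = (of_int (q * (q - 1)) / 2 * form (mode ?aa 0 x) y
       + of_int ((q - 1)\<^sup>2) * form (mode a 0 x) (mode a 0 y)
       + (if q = 2 then 2 * form a x * form a y else 0)) *s vac"
      unfolding 1 2 3 mode_griess_2[OF a x] mode_griess_2[OF a y]
      by (auto simp: algebra_simps power2_eq_square simp flip: scale_left_distrib scale_left_diff_distrib)
    finally show ?thesis .
  qed
  have "mode a q (mode a q (casimir (2 * q))) = (\<Sum>s\<in>S. mode a q (mode a q (mode (du s) (2 - 2 * q) s)))"
    by (simp add: casimir_def mode_sum)
  also have "\<dots> = (\<Sum>s\<in>S. of_int (q * (q - 1)) / 2 * form (mode ?aa 0 (du s)) s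
       + of_int ((q - 1)\<^sup>2) * form (mode a 0 (du s)) (mode a 0 s)
       + (if q = 2 then 2 * form a (du s) * form a s else 0)) *s vac"
    unfolding scale_sum_left by (rule sum.cong) (simp_all add: summand du_griess S_griess)
  also have "(\<Sum>s\<in>S. of_int (q * (q - 1)) / 2 * form (mode ?aa 0 (du s)) s
       + of_int ((q - 1)\<^sup>2) * form (mode a 0 (du s)) (mode a 0 s)
       + (if q = 2 then 2 * form a (du s) * form a s else 0)) =
     of_int (q * (q - 1)) / 2 * tr1 ?aa + of_int ((q - 1)\<^sup>2) * tr2 a
     + (if q = 2 then 2 * (\<Sum>s\<in>S. form a (du s) * form a s) else 0)"
    by (simp add: sum.distrib tr1_def tr2_def sum_distrib_left mult.assoc)
  also have "(\<Sum>s\<in>S. form a (du s) * form a s) = form a (\<Sum>s\<in>S. form a s *s du s)"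
    by (simp add: form_sum du_griess a mult.commute)
  also have "\<dots> = form a a" by (simp add: expand_dual a)
  finally show ?thesis .
qed

end

section \<open>Automorphisms and fixed vectors\<close>

context vertex_operator_algebra
begin

lemma Aut_props:
  assumes "g \<in> Aut"
  shows "bij g" "g (x + y) = g x + g y" "g (k *s x) = k *s g x"
    "g (prd x n y) = prd (g x) n (g y)" "g om = om" "g vac = vac"
proof -
  show g: "bij g" "g (x + y) = g x + g y" "g (k *s x) = k *s g x"
    "g (prd x n y) = prd (g x) n (g y)" "g om = om" for x y n
    using assms by (auto simp: Aut_def Vector_Spaces.linear_iff)
  obtain b where b: "g b = vac"
    using bij_pointE[OF g(1)] by metis
  have "g vac = prd (g vac) (- 1) vac"
    by (simp add: vac_right)
  also have "\<dots> = vac"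
    using g(4)[of vac "- 1" b] by (simp add: b vac_left)
  finally show "g vac = vac" .
qed

lemma Aut_inv:
  assumes "g \<in> Aut"
  shows "inv g \<in> Aut"
proof -
  note g = Aut_props[OF assms]
  have i: "inv g y = x \<longleftrightarrow> y = g x" for x y
    using g(1) by (metis bij_inv_eq_iff)
  have gi: "g (inv g x) = x" for x
    by (simp add: bij_is_surj g(1) surj_f_inv_f)
  show ?thesis
    unfolding Aut_def Vector_Spaces.linear_iff
    using bij_imp_bij_inv[OF g(1)] by (simp add: i g(2-5) gi vector_space_axioms)
qed

lemma Aut_L: "g \<in> Aut \<Longrightarrow> g (L m v) = L m (g v)"
  by (simp add: L_def Aut_props)

lemma Aut_wt: "g \<in> Aut \<Longrightarrow> v \<in> wt n \<Longrightarrow> g v \<in> wt n"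
  by (simp add: wt_def Aut_props flip: Aut_L)

lemma Aut_zero: "g \<in> Aut \<Longrightarrow> g 0 = 0"
  using Aut_props(3)[of g 0 0] by simp

lemma Aut_sum: "g \<in> Aut \<Longrightarrow> g (sum f A) = (\<Sum>x\<in>A. g (f x))"
  by (induction A rule: infinite_finite_induct) (simp_all add: Aut_zero Aut_props(2))

lemma Aut_wt_upto:
  assumes g: "g \<in> Aut" and v: "v \<in> wt_upto n"
  shows "g v \<in> wt_upto n"
  using v unfolding wt_upto_def
proof (induction rule: span_induct_alt)
  case (step r x y)
  then have "g x \<in> (\<Union>m\<le>n. wt m)" using Aut_wt[OF g] by auto
  then show ?case
    using step by (auto simp: Aut_props[OF g] intro!: span_add span_scale intro: span_base)
qed (simp add: Aut_zero[OF g] span_zero)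

lemma vir_sub_props: "subspace vir_sub" "vac \<in> vir_sub" "w \<in> vir_sub \<Longrightarrow> L m w \<in> vir_sub"
  unfolding vir_sub_def by (auto intro!: subspace_Inter)

lemma Aut_vir_sub:
  assumes g: "g \<in> Aut" and v: "v \<in> vir_sub"
  shows "g v \<in> vir_sub"
proof -
  have "vir_sub \<subseteq> {w. g w \<in> vir_sub}"
    unfolding vir_sub_def
    by (rule Inter_lower, fold vir_sub_def)
      (auto intro!: subspaceI simp: Aut_props[OF g] Aut_zero[OF g] Aut_L[OF g] vir_sub_props
        subspace_0[OF vir_sub_props(1)] subspace_add[OF vir_sub_props(1)] subspace_scale[OF vir_sub_props(1)])
  then show ?thesis using v by auto
qed

text \<open>
  The coset of a fixed vector is a fixed point of the quotient, because automorphisms preserve the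
  Virasoro submodule and the weight filtration; an automorphism maps these subspaces onto themselves
  as its inverse is an automorphism too.
\<close>

lemma class_S_fixed_point:
  assumes S: "class_S n" and v: "v \<in> wt_upto n" and fixed: "\<And>g. g \<in> Aut \<Longrightarrow> g v = v"
  shows "v \<in> vir_sub"
proof -
  let ?W = "vir_sub \<inter> wt_upto n" and ?X = "(\<lambda>w. v + w) ` (vir_sub \<inter> wt_upto n)"
  have "g ` ?X = ?X" if g: "g \<in> Aut" for g
  proof -
    have W: "h w \<in> ?W" if "h \<in> Aut" "w \<in> ?W" for h w
      using that Aut_vir_sub Aut_wt_upto by blast
    have "g ` ?W = ?W"
    proof
      show "?W \<subseteq> g ` ?W"
      proof
        fix w assume "w \<in> ?W"
        then have "inv g w \<in> ?W" by (rule W[OF Aut_inv[OF g]])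
        moreover have "w = g (inv g w)"
          by (simp add: bij_is_surj Aut_props(1)[OF g] surj_f_inv_f)
        ultimately show "w \<in> g ` ?W" by (rule rev_image_eqI)
      qed
    qed (use W[OF g] in blast)
    moreover have "g ` ?X = (\<lambda>w. v + w) ` (g ` ?W)"
      by (simp add: image_image Aut_props(2)[OF g] fixed[OF g])
    ultimately show ?thesis by simp
  qed
  moreover have "?X \<in> quotient_space (wt_upto n) ?W"
    unfolding quotient_space_def using v by (rule imageI)
  ultimately have "?X = ?W"
    using S[unfolded class_S_def, rule_format, of ?X] by blast
  moreover have "v + 0 \<in> ?X"
    by (rule imageI) (simp add: wt_upto_def span_zero subspace_0[OF vir_sub_props(1)])
  ultimately show ?thesis by auto
qed

end

context griess_voa
begin

lemma Aut_griess: "g \<in> Aut \<Longrightarrow> a \<in> griess \<Longrightarrow> g a \<in> griess"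
  by (simp add: griess_def Aut_wt)

lemma Aut_mode: "g \<in> Aut \<Longrightarrow> g (mode a n b) = mode (g a) n (g b)"
  by (simp add: mode_def Aut_props)

lemma Aut_form:
  assumes g: "g \<in> Aut" and ab: "a \<in> griess" "b \<in> griess"
  shows "form (g a) (g b) = form a b"
proof (rule formI)
  have "prd (g a) 3 (g b) = g (mode a 2 b)"
    by (simp add: mode_def Aut_props[OF g])
  also have "\<dots> = form a b *s vac"
    by (simp add: mode_griess_2 ab Aut_props[OF g])
  finally show "prd (g a) 3 (g b) = form a b *s vac" .
qed

end

context griess_casimir
begin

text \<open>
  Applying \<open>g\<close> replaces a pair of dual bases by another one. Expanding the new dual basis in
  the old one and collecting the coefficients reproduces the old sum.
\<close>

lemma Aut_casimir:
  assumes g: "g \<in> Aut"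
  shows "g (casimir n) = casimir n"
proof -
  have gi: "g (inv g x) = x" for x
    by (simp add: bij_is_surj Aut_props(1)[OF g] surj_f_inv_f)
  have "g (casimir n) = (\<Sum>s\<in>S. mode (g (du s)) (2 - n) (g s))"
    by (simp add: casimir_def Aut_sum[OF g] Aut_mode[OF g])
  also have "\<dots> = (\<Sum>s\<in>S. \<Sum>t\<in>S. form (g (du s)) t *s mode (du t) (2 - n) (g s))"
  proof (rule sum.cong[OF refl])
    fix s assume "s \<in> S"
    then have "g (du s) \<in> griess" by (intro Aut_griess[OF g] du_griess)
    then have "mode (g (du s)) (2 - n) (g s) = mode (\<Sum>t\<in>S. form (g (du s)) t *s du t) (2 - n) (g s)"
      by (simp add: expand_dual)
    then show "mode (g (du s)) (2 - n) (g s) = (\<Sum>t\<in>S. form (g (du s)) t *s mode (du t) (2 - n) (g s))"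
      by (simp add: mode_sum)
  qed
  also have "\<dots> = (\<Sum>t\<in>S. mode (du t) (2 - n) (\<Sum>s\<in>S. form (g (du s)) t *s g s))"
    by (subst sum.swap) (simp add: mode_sum)
  also have "\<dots> = casimir n"
    unfolding casimir_def
  proof (rule sum.cong[OF refl])
    fix t assume t: "t \<in> S"
    have t': "inv g t \<in> griess"
      using Aut_griess[OF Aut_inv[OF g]] t S_griess by blast
    have "(\<Sum>s\<in>S. form (g (du s)) t *s g s) = (\<Sum>s\<in>S. form (du s) (inv g t) *s g s)"
      using Aut_form[OF g du_griess t'] by (intro sum.cong) (simp_all add: gi)
    also have "\<dots> = g (\<Sum>s\<in>S. form (du s) (inv g t) *s s)"
      by (simp add: Aut_sum[OF g] Aut_props[OF g])
    also have "\<dots> = t"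
      by (simp add: expand_basis t' gi)
    finally show "mode (du t) (2 - n) (\<Sum>s\<in>S. form (g (du s)) t *s g s) = mode (du t) (2 - n) t"
      by simp
  qed
  finally show ?thesis .
qed

lemma casimir_vir_sub:
  assumes "class_S n" "m \<le> n"
  shows "casimir (int m) \<in> span (word ` set (partitions m m))"
proof (rule vir_sub_wt[OF class_S_fixed_point[OF assms(1)]])
  show "casimir (int m) \<in> wt m" by (rule casimir_wt)
  then show "casimir (int m) \<in> wt_upto n"
    unfolding wt_upto_def using assms(2) by (intro span_base) auto
qed (rule Aut_casimir)

end

section \<open>Trace formulas from the weights 4, 6 and 8\<close>

context griess_casimir
begin

text \<open>
  The rules from here to \<open>mode_mode_vac\<close> form a rewriting system that evaluates words of positive
  modes on words of negative modes: $L_m$ moves to the right of all smaller indices, a mode of a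
  primary vector \<open>a\<close> moves to the right of all Virasoro modes, and nonnegative modes vanish on
  the vacuum.
\<close>

lemma L_sort:
  "n < m \<Longrightarrow> L m (L n v) = L n (L m v) + of_int (m - n) *s L (m + n) v
     + (if m + n = 0 then of_int (m ^ 3 - m) / 12 * c else 0) *s v"
  by (rule L_comm)

text \<open>
  As the Virasoro modes contain the conformal vector, rewriting it to $L_{-2}\mathbf 1$ would not
  terminate; the conformal vector is therefore replaced in this one rule.
\<close>

lemma L_casimir_vac:
  "m \<ge> 1 \<Longrightarrow> L m (casimir n) = of_int (m + n - 2) *s casimir (n - m)
    + (if m = n - 2 then of_int (m ^ 3 - m) / 6 else 0) *s L (- 2) vac
    + (if m = 2 then L (2 - n) vac else 0)"
  using L_casimir[of m n] by (simp only: L_om)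

lemmas evaluation = L_sort L_vac L_casimir_vac casimir_0 casimir_1 scale_left_distrib[symmetric]
  vac_coeff_eq vac_nonzero

lemma mode_sort:
  assumes "a \<in> griess" "form om a = 0"
  shows "mode a p (L n v) = L n (mode a p v) + of_int (p - n) *s mode a (p + n) v"
  using L_mode_commute[OF assms(1), of n p v] assms(2)
  by (simp add: algebra_simps scale_left_diff_distrib)

lemma mode_mode_vac:
  assumes "a \<in> griess" "p \<ge> - 1" "p + q \<ge> 0"
  shows "mode a p (mode a q vac) = (if p + q = 0 then of_int (p ^ 3 - p) / 6 * form a a else 0) *s vac"
  using griess_commutator[OF assms(1,1), of p q vac] assms(2,3)
  by (simp add: vac_right_nonneg)

text \<open>
  The Casimir vector of weight 2 is a multiple of the conformal vector, hence the trace of a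
  multiplication is a multiple of the form with the conformal vector.
\<close>

lemma tr1_square:
  assumes a: "a \<in> griess" "form om a = 0" and S: "class_S n" "2 \<le> n"
  shows "c * tr1 (mode a 0 a) = 8 * of_nat (card S) * form a a"
proof -
  let ?aa = "mode a 0 a"
  have aa: "?aa \<in> griess" by (simp add: mode_griess_0 a)
  from casimir_vir_sub[OF S] obtain s where casimir: "casimir 2 = s *s L (- 2) vac"
    by (auto simp: partitions_values span_singleton)
  have s: "c * s = 4 * of_nat (card S)"
    using arg_cong[OF casimir, of "\<lambda>v. L 2 v"] by (simp add: evaluation)
  have "L 2 ?aa = (2 * form a a) *s vac"
    using L_mode_commute[OF a(1), of 2 0 a] L_griess[OF a(1), of 2] by (simp add: mode_griess_2 a)
  then have "form om ?aa = 2 * form a a"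
    using L_griess[OF aa, of 2] by (simp add: vac_coeff_eq vac_nonzero)
  then have "tr1 ?aa = s * (2 * form a a)"
    using aa by (simp add: tr1_casimir casimir L_om form_linear om_griess form_commute[of ?aa])
  then have "c * tr1 ?aa = (c * s) * (2 * form a a)" by simp
  then show ?thesis by (simp add: s)
qed

text \<open>
  In a vertex operator algebra of class $\mathcal S^n$ the Casimir vector of weight \<open>2q\<close> is a combination, with unknown
  coefficients \<open>s1\<close>, \<open>s2\<close> and so on, of the Virasoro words of that weight. Applying the Virasoro monomials $L_\mu$,
  one for each partition \<open>\<mu>\<close> into parts at least 2, gives as many linear equations for them; their
  matrix is the Gram matrix of the invariant form on the Virasoro module. Applying $a[q]a[q]$, for \<open>a\<close>
  orthogonal to the conformal vector, expresses the traces by the same unknowns. The unknowns are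
  eliminated by a combination of the linear equations whose multipliers solve the transposed Gram
  system, scaled by the factors of the Gram determinant so as to become polynomials.
\<close>

lemma trace_4:
  assumes a: "a \<in> griess" "form om a = 0" and S: "class_S n" "4 \<le> n"
  shows "(c * (5 * c + 22)) * tr2 a =
    (- 10 * c^2 + (- 4 * c + 176) * of_nat (card S)) * form a a"
proof -
  let ?d = "of_nat (card S) :: complex"
  from casimir_vir_sub[OF S] obtain s1 s2 where casimir: "casimir 4 =
    s1 *s L (-2) (L (-2) vac) + s2 *s L (-4) vac"
    by (auto simp: partitions_values span_breakdown_eq algebra_simps)
  have r4: "3 * c * s1 + 5 * c * s2 = 6 * ?d"
    using arg_cong[OF casimir, of "\<lambda>v. L 4 v"] by (simp (no_asm_use) add: evaluation) algebra
  have r22: "(c^2 + 8 * c) / 2 * s1 + 3 * c * s2 = c + 8 * ?d"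
    using arg_cong[OF casimir, of "\<lambda>v. L 2 (L 2 v)"] by (simp (no_asm_use) add: evaluation) algebra
  have v: "tr1 (mode a 0 a) + tr2 a + 2 * form a a = (8 * s1 + 6 * s2) * form a a"
    using arg_cong[OF casimir, of "\<lambda>v. mode a 2 (mode a 2 v)"] mode_mode_casimir[OF a(1), of 2]
    by (simp add: evaluation mode_sort[OF a] mode_mode_vac[OF a(1)] power2_eq_square del: mode_vac(2))
      (simp add: algebra_simps)
  have t: "c * tr1 (mode a 0 a) = 8 * ?d * form a a"
    using tr1_square[OF a S(1)] S(2) by simp
  have "c * (5 * c + 22) * (8 * s1 + 6 * s2) =
    (6 * c) * (3 * c * s1 + 5 * c * s2)
      + (44) * ((c^2 + 8 * c) / 2 * s1 + 3 * c * s2)"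
    by algebra
  also have "\<dots> =
    (6 * c) * (6 * ?d)
      + (44) * (c + 8 * ?d)"
    unfolding r4 r22 ..
  finally have e: "c * (5 * c + 22) * (8 * s1 + 6 * s2) = \<dots>" .
  have "(c * (5 * c + 22)) * tr2 a = c * (5 * c + 22) * (tr1 (mode a 0 a) + tr2 a + 2 * form a a)
      - ((5 * c + 22)) * (c * tr1 (mode a 0 a)) - 2 * (c * (5 * c + 22)) * form a a"
    by algebra
  also have "\<dots> = (c * (5 * c + 22) * (8 * s1 + 6 * s2)) * form a a
      - ((5 * c + 22)) * (8 * ?d * form a a) - 2 * (c * (5 * c + 22)) * form a a"
    unfolding v t by (simp only: mult.assoc)
  also have "\<dots> = (- 10 * c^2 + (- 4 * c + 176) * ?d) * form a a"
    unfolding e by algebra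
  finally show ?thesis .
qed

lemma trace_6:
  assumes a: "a \<in> griess" "form om a = 0" and S: "class_S n" "6 \<le> n"
  shows "4 * (c * (2 * c - 1) * (5 * c + 22) * (7 * c + 68)) * tr2 a =
    (2480 * c^3 + 21824 * c^2 + (- 240 * c^3 + 8672 * c^2
        + 79936 * c - 47872) * of_nat (card S)) * form a a"
proof -
  let ?d = "of_nat (card S) :: complex"
  from casimir_vir_sub[OF S] obtain s1 s2 s3 s4 where casimir: "casimir 6 =
    s1 *s L (-2) (L (-2) (L (-2) vac)) + s2 *s L (-3) (L (-3) vac) + s3 *s L (-4) (L (-2) vac)
        + s4 *s L (-6) vac"
    by (auto simp: partitions_values span_breakdown_eq algebra_simps)
  have r6: "24 * c * s1 + 18 * c * s2 + 5 * c * s3 + (35 * c) / 2 * s4 = 10 * ?d"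
    using arg_cong[OF casimir, of "\<lambda>v. L 6 v"] by (simp (no_asm_use) add: evaluation) algebra
  have r24: "(9 * c^2 + 144 * c) / 2 * s1 + 50 * c * s2 + (5 * c^2 + 36 * c) / 2 * s3
      + 40 * c * s4 = 5 * c + 36 * ?d"
    using arg_cong[OF casimir, of "\<lambda>v. L 4 (L 2 v)"] by (simp (no_asm_use) add: evaluation) algebra
  have r33: "30 * c * s1 + (8 * c^2 + 36 * c) * s2 + 14 * c * s3 + 18 * c * s4 = 28 * ?d"
    using arg_cong[OF casimir, of "\<lambda>v. L 3 (L 3 v)"] by (simp (no_asm_use) add: evaluation) algebra
  have r222: "(3 * c^3 + 72 * c^2 + 384 * c) / 4 * s1 + 30 * c * s2 + (9 * c^2 + 48 * c) / 2 * s3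
      + 24 * c * s4 = 9 * c + 48 * ?d"
    using arg_cong[OF casimir, of "\<lambda>v. L 2 (L 2 (L 2 v))"] by (simp (no_asm_use) add: evaluation) algebra
  have v: "3 * tr1 (mode a 0 a) + 4 * tr2 a = (60 * s1 + 72 * s2 + 28 * s3 + 36 * s4) * form a a"
    using arg_cong[OF casimir, of "\<lambda>v. mode a 3 (mode a 3 v)"] mode_mode_casimir[OF a(1), of 3]
    by (simp add: evaluation mode_sort[OF a] mode_mode_vac[OF a(1)] power2_eq_square del: mode_vac(2))
      (simp add: algebra_simps)
  have t: "c * tr1 (mode a 0 a) = 8 * ?d * form a a"
    using tr1_square[OF a S(1)] S(2) by simp
  have "c * (2 * c - 1) * (5 * c + 22) * (7 * c + 68) * (60 * s1 + 72 * s2 + 28 * s3 + 36 * s4) =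
    (144 * c^3 + 512 * c^2 - 13312 * c) * (24 * c * s1 + 18 * c * s2 + 5 * c * s3 + (35 * c) / 2 * s4)
      + (496 * c^2 + 7936 * c) * ((9 * c^2 + 144 * c) / 2 * s1 + 50 * c * s2 + (5 * c^2
          + 36 * c) / 2 * s3 + 40 * c * s4)
      + (306 * c^2 + 2948 * c - 2992) * (30 * c * s1 + (8 * c^2 + 36 * c) * s2 + 14 * c * s3
          + 18 * c * s4)
      + (- 1984 * c) * ((3 * c^3 + 72 * c^2 + 384 * c) / 4 * s1 + 30 * c * s2 + (9 * c^2
          + 48 * c) / 2 * s3 + 24 * c * s4)"
    by algebra
  also have "\<dots> =
    (144 * c^3 + 512 * c^2 - 13312 * c) * (10 * ?d)
      + (496 * c^2 + 7936 * c) * (5 * c + 36 * ?d)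
      + (306 * c^2 + 2948 * c - 2992) * (28 * ?d)
      + (- 1984 * c) * (9 * c + 48 * ?d)"
    unfolding r6 r24 r33 r222 ..
  finally have e: "c * (2 * c - 1) * (5 * c + 22) * (7 * c + 68) * (60 * s1 + 72 * s2 + 28 * s3
      + 36 * s4) = \<dots>" .
  have "4 * (c * (2 * c - 1) * (5 * c + 22) * (7 * c + 68)) * tr2 a = c * (2 * c - 1) * (5 * c + 22) * (7 * c + 68) * (3 * tr1 (mode a 0 a) + 4 * tr2 a)
      - 3 * ((2 * c - 1) * (5 * c + 22) * (7 * c + 68)) * (c * tr1 (mode a 0 a))"
    by algebra
  also have "\<dots> = (c * (2 * c - 1) * (5 * c + 22) * (7 * c + 68) * (60 * s1 + 72 * s2 + 28 * s3
      + 36 * s4)) * form a a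
      - 3 * ((2 * c - 1) * (5 * c + 22) * (7 * c + 68)) * (8 * ?d * form a a)"
    unfolding v t by (simp only: mult.assoc)
  also have "\<dots> = (2480 * c^3 + 21824 * c^2 + (- 240 * c^3 + 8672 * c^2
      + 79936 * c - 47872) * ?d) * form a a"
    unfolding e by algebra
  finally show ?thesis .
qed

lemma trace_8:
  assumes a: "a \<in> griess" "form om a = 0" and S: "class_S n" "8 \<le> n"
  shows "9 * (c * (2 * c - 1) * (3 * c + 46) * (5 * c + 3) * (5 * c + 22) * (7 * c + 68)) * tr2 a =
    (84000 * c^5 + 2057100 * c^4 + 12572040 * c^3 + 8575776 * c^2 + (- 8400 * c^5 + 176700 * c^4
        + 7220544 * c^3 + 42263136 * c^2 - 923040 * c - 14864256) * of_nat (card S)) * form a a"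
proof -
  let ?d = "of_nat (card S) :: complex"
  from casimir_vir_sub[OF S] obtain s1 s2 s3 s4 s5 s6 s7 where casimir: "casimir 8 =
    s1 *s L (-2) (L (-2) (L (-2) (L (-2) vac))) + s2 *s L (-3) (L (-3) (L (-2) vac))
        + s3 *s L (-4) (L (-2) (L (-2) vac)) + s4 *s L (-4) (L (-4) vac) + s5 *s L (-5) (L (-3) vac)
          + s6 *s L (-6) (L (-2) vac) + s7 *s L (-8) vac"
    by (auto simp: partitions_values span_breakdown_eq algebra_simps)
  have r8: "240 * c * s1 + 44 * c * s2 + 36 * c * s3 + 60 * c * s4 + 26 * c * s5 + 7 * c * s6
      + 42 * c * s7 = 14 * ?d"
    using arg_cong[OF casimir, of "\<lambda>v. L 8 v"] by (simp (no_asm_use) add: evaluation) algebra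
  have r26: "(48 * c^2 + 1152 * c) * s1 + (9 * c^2 + 230 * c) * s2 + (5 * c^2 + 184 * c) * s3
      + 270 * c * s4 + 126 * c * s5 + (35 * c^2 + 160 * c) / 4 * s6 + 175 * c * s7 = (35 * c) / 2
          + 80 * ?d"
    using arg_cong[OF casimir, of "\<lambda>v. L 6 (L 2 v)"] by (simp (no_asm_use) add: evaluation) algebra
  have r35: "690 * c * s1 + (16 * c^2 + 168 * c) * s2 + 126 * c * s3 + 210 * c * s4 + (20 * c^2
      + 112 * c) * s5 + 36 * c * s6 + 110 * c * s7 = 72 * ?d"
    using arg_cong[OF casimir, of "\<lambda>v. L 5 (L 3 v)"] by (simp (no_asm_use) add: evaluation) algebra
  have r44: "(54 * c^2 + 576 * c) * s1 + 84 * c * s2 + (30 * c^2 + 96 * c) * s3 + (50 * c^2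
      + 160 * c) * s4 + 90 * c * s5 + 30 * c * s6 + 60 * c * s7 = 60 * ?d"
    using arg_cong[OF casimir, of "\<lambda>v. L 4 (L 4 v)"] by (simp (no_asm_use) add: evaluation) algebra
  have r224: "(9 * c^3 + 360 * c^2 + 3456 * c) * s1 + (50 * c^2 + 680 * c) * s2 + (5 * c^3
      + 130 * c^2 + 1152 * c) / 2 * s3 + (30 * c^2 + 696 * c) * s4 + 350 * c * s5 + (40 * c^2
          + 144 * c) * s6 + 400 * c * s7 = 80 * c + 288 * ?d"
    using arg_cong[OF casimir, of "\<lambda>v. L 4 (L 2 (L 2 v))"] by (simp (no_asm_use) add: evaluation) algebra
  have r233: "(60 * c^2 + 1440 * c) * s1 + (4 * c^3 + 98 * c^2 + 500 * c) * s2 + (14 * c^2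
      + 292 * c) * s3 + 384 * c * s4 + (56 * c^2 + 252 * c) * s5 + (9 * c^2 + 112 * c) * s6
          + 180 * c * s7 = 18 * c + 224 * ?d"
    using arg_cong[OF casimir, of "\<lambda>v. L 3 (L 3 (L 2 v))"] by (simp (no_asm_use) add: evaluation) algebra
  have r2222: "(3 * c^4 + 144 * c^3 + 2112 * c^2 + 9216 * c) / 2 * s1 + (60 * c^2 + 540 * c) * s2
      + (9 * c^3 + 168 * c^2 + 768 * c) * s3 + (54 * c^2 + 576 * c) * s4 + 210 * c * s5 + (48 * c^2
          + 192 * c) * s6 + 240 * c * s7 = 96 * c + 384 * ?d"
    using arg_cong[OF casimir, of "\<lambda>v. L 2 (L 2 (L 2 (L 2 v)))"] by (simp (no_asm_use) add: evaluation) algebra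
  have v: "6 * tr1 (mode a 0 a) + 9 * tr2 a = (1152 * s1 + 168 * s2 + 192 * s3 + 320 * s4 + 180 * s5
      + 60 * s6 + 120 * s7) * form a a"
    using arg_cong[OF casimir, of "\<lambda>v. mode a 4 (mode a 4 v)"] mode_mode_casimir[OF a(1), of 4]
    by (simp add: evaluation mode_sort[OF a] mode_mode_vac[OF a(1)] power2_eq_square del: mode_vac(2))
      (simp add: algebra_simps)
  have t: "c * tr1 (mode a 0 a) = 8 * ?d * form a a"
    using tr1_square[OF a S(1)] S(2) by simp
  have "c * (2 * c - 1) * (3 * c + 46) * (5 * c + 3) * (5 * c + 22) * (7 * c + 68) * (1152 * s1
      + 168 * s2 + 192 * s3 + 320 * s4 + 180 * s5 + 60 * s6 + 120 * s7) =
    (3000 * c^5 + 49650 * c^4 - 443460 * c^3 - 9919920 * c^2 - 10802880 * c) * (240 * c * s1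
        + 44 * c * s2 + 36 * c * s3 + 60 * c * s4 + 26 * c * s5 + 7 * c * s6 + 42 * c * s7)
      + (4800 * c^4 + 183960 * c^3 + 2891664 * c^2 + 4905792 * c) * ((48 * c^2 + 1152 * c) * s1
          + (9 * c^2 + 230 * c) * s2 + (5 * c^2 + 184 * c) * s3 + 270 * c * s4 + 126 * c * s5
          + (35 * c^2 + 160 * c) / 4 * s6 + 175 * c * s7)
      + (5550 * c^4 + 200640 * c^3 + 1884504 * c^2 + 45216 * c) * (690 * c * s1 + (16 * c^2
          + 168 * c) * s2 + 126 * c * s3 + 210 * c * s4 + (20 * c^2 + 112 * c) * s5 + 36 * c * s6
          + 110 * c * s7)
      + (3120 * c^4 + 85526 * c^3 + 675312 * c^2 + 203128 * c - 412896) * ((54 * c^2 + 576 * c) * s1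
          + 84 * c * s2 + (30 * c^2 + 96 * c) * s3 + (50 * c^2 + 160 * c) * s4 + 90 * c * s5
          + 30 * c * s6 + 60 * c * s7)
      + (- 9600 * c^3 - 532128 * c^2 - 1206144 * c) * ((9 * c^3 + 360 * c^2 + 3456 * c) * s1
          + (50 * c^2 + 680 * c) * s2 + (5 * c^3 + 130 * c^2 + 1152 * c) / 2 * s3 + (30 * c^2
          + 696 * c) * s4 + 350 * c * s5 + (40 * c^2 + 144 * c) * s6 + 400 * c * s7)
      + (- 21900 * c^3 - 377640 * c^2 + 80928 * c) * ((60 * c^2 + 1440 * c) * s1 + (4 * c^3
          + 98 * c^2 + 500 * c) * s2 + (14 * c^2 + 292 * c) * s3 + 384 * c * s4 + (56 * c^2
          + 252 * c) * s5 + (9 * c^2 + 112 * c) * s6 + 180 * c * s7)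
      + (118080 * c^2 + 184992 * c) * ((3 * c^4 + 144 * c^3 + 2112 * c^2 + 9216 * c) / 2 * s1
          + (60 * c^2 + 540 * c) * s2 + (9 * c^3 + 168 * c^2 + 768 * c) * s3 + (54 * c^2
          + 576 * c) * s4 + 210 * c * s5 + (48 * c^2 + 192 * c) * s6 + 240 * c * s7)"
    by algebra
  also have "\<dots> =
    (3000 * c^5 + 49650 * c^4 - 443460 * c^3 - 9919920 * c^2 - 10802880 * c) * (14 * ?d)
      + (4800 * c^4 + 183960 * c^3 + 2891664 * c^2 + 4905792 * c) * ((35 * c) / 2 + 80 * ?d)
      + (5550 * c^4 + 200640 * c^3 + 1884504 * c^2 + 45216 * c) * (72 * ?d)
      + (3120 * c^4 + 85526 * c^3 + 675312 * c^2 + 203128 * c - 412896) * (60 * ?d)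
      + (- 9600 * c^3 - 532128 * c^2 - 1206144 * c) * (80 * c + 288 * ?d)
      + (- 21900 * c^3 - 377640 * c^2 + 80928 * c) * (18 * c + 224 * ?d)
      + (118080 * c^2 + 184992 * c) * (96 * c + 384 * ?d)"
    unfolding r8 r26 r35 r44 r224 r233 r2222 ..
  finally have e: "c * (2 * c - 1) * (3 * c + 46) * (5 * c + 3) * (5 * c + 22) * (7 * c
      + 68) * (1152 * s1 + 168 * s2 + 192 * s3 + 320 * s4 + 180 * s5 + 60 * s6 + 120 * s7) = \<dots>" .
  have "9 * (c * (2 * c - 1) * (3 * c + 46) * (5 * c + 3) * (5 * c + 22) * (7 * c + 68)) * tr2 a = c * (2 * c - 1) * (3 * c + 46) * (5 * c + 3) * (5 * c + 22) * (7 * c + 68) * (6 * tr1 (mode a 0 a) + 9 * tr2 a)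
      - 6 * ((2 * c - 1) * (3 * c + 46) * (5 * c + 3) * (5 * c + 22) * (7 * c + 68)) * (c * tr1 (mode a 0 a))"
    by algebra
  also have "\<dots> = (c * (2 * c - 1) * (3 * c + 46) * (5 * c + 3) * (5 * c + 22) * (7 * c
      + 68) * (1152 * s1 + 168 * s2 + 192 * s3 + 320 * s4 + 180 * s5 + 60 * s6 + 120 * s7)) * form a a
      - 6 * ((2 * c - 1) * (3 * c + 46) * (5 * c + 3) * (5 * c + 22) * (7 * c + 68)) * (8 * ?d * form a a)"
    unfolding v t by (simp only: mult.assoc)
  also have "\<dots> = (84000 * c^5 + 2057100 * c^4 + 12572040 * c^3 + 8575776 * c^2 + (- 8400 * c^5
      + 176700 * c^4 + 7220544 * c^3 + 42263136 * c^2 - 923040 * c - 14864256) * ?d) * form a a"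
    unfolding e by algebra
  finally show ?thesis .
qed

end

section \<open>The dimension of the Griess algebra\<close>

context griess_casimir
begin

text \<open>
  An idempotent of central charge \<open>b\<close>, corrected by a multiple of the conformal vector, is orthogonal to
  the latter and has square norm $b(c-b)/2c$; this is where properness enters.
\<close>

lemma primary_vector_from_idempotent:
  assumes e: "proper_idempotent e" and c: "c \<noteq> 0"
  shows "\<exists>a\<in>griess. form om a = 0 \<and> form a a \<noteq> 0"
proof -
  let ?b = "central_charge e"
  let ?u = "(?b / c) *s om"
  have eg: "e \<in> griess" and ee: "mode e 0 e = 2 *s e" and b: "?b \<noteq> 0" "?b \<noteq> c"
    using e by (simp_all add: proper_idempotent_def idempotent_def mode_def)
  have u: "?u \<in> griess" by (rule subspace_scale[OF subspace_griess om_griess])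
  have "mode om 0 e = 2 *s e"
    using eg by (simp add: griess_def wt_def flip: L_eq_mode)
  then have "2 * form e e = 2 * form om e"
    using form_invariant[OF om_griess eg eg] by (simp add: ee form_scale eg om_griess)
  then have oe: "form om e = ?b / 2" and fe: "form e e = ?b / 2"
    by (simp_all add: central_charge_def)
  have "form om (e - ?u) = 0"
    using c by (simp add: form_linear eg om_griess u oe form_om_om)
  moreover have "form (e - ?u) (e - ?u) = ?b * (c - ?b) / (2 * c)"
    using c by (simp add: form_linear eg om_griess u subspace_diff[OF subspace_griess]
        form_commute[of e om] oe fe form_om_om field_simps)
  moreover have "e - ?u \<in> griess"
    by (rule subspace_diff[OF subspace_griess eg u])
  ultimately show ?thesis
    using b c by (intro bexI[of _ "e - ?u"]) auto
qed

lemma card_S_neq_1: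
  assumes a: "a \<in> griess" "form om a = 0" "form a a \<noteq> 0" and c: "c \<noteq> 0"
  shows "card S \<noteq> 1"
proof
  assume "card S = 1"
  then obtain x where x: "S = {x}" by (rule card_1_singletonE)
  have xg: "x \<in> griess" using S_griess x by simp
  have expand: "v = form (du x) v *s x" if "v \<in> griess" for v
    using expand_basis[OF that] by (simp add: x)
  obtain r t where r: "a = r *s x" and t: "om = t *s x"
    using expand[OF a(1)] expand[OF om_griess] by metis
  have *: "form (k *s x) (l *s x) = k * l * form x x" for k l
    using xg subspace_scale[OF subspace_griess xg] by (simp add: form_scale)
  have "form a a = r * r * form x x" "form om a = t * r * form x x" "form om om = t * t * form x x"
    using *[of r r] *[of t r] *[of t t] by (simp_all only: r[symmetric] t[symmetric])
  then show False
    using a(2,3) c form_om_om by auto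
qed

text \<open>
  Weights 4 and 6 give two formulas for \<open>tr2 a / form a a\<close>, which is possible only for one value
  of the dimension.
\<close>

lemma dimension_class_6:
  assumes S: "class_S n" "6 \<le> n" and e: "proper_idempotent e"
    and c: "c * (2 * c - 1) * (5 * c + 22) * (7 * c + 68) \<noteq> 0"
  shows "of_nat (card S) = (70 * c^2 + 955 * c + 2388) * c / (2 * (c^2 - 55 * c + 748))"
proof -
  let ?d = "of_nat (card S) :: complex"
  have c0: "c \<noteq> 0" using c by simp
  obtain a where a: "a \<in> griess" "form om a = 0" "form a a \<noteq> 0"
    using primary_vector_from_idempotent[OF e c0] by blast
  have 4: "c * (5 * c + 22) * tr2 a = (- 10 * c^2 + (- 4 * c + 176) * ?d) * form a a"
    using trace_4[OF a(1,2) S(1)] S(2) by simp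
  have 6: "4 * (c * (2 * c - 1) * (5 * c + 22) * (7 * c + 68)) * tr2 a =
      (2480 * c^3 + 21824 * c^2 + (- 240 * c^3 + 8672 * c^2 + 79936 * c - 47872) * ?d) * form a a"
    using trace_6[OF a(1,2) S] .
  have "8 * c * ((70 * c^2 + 955 * c + 2388) * c - 2 * (c^2 - 55 * c + 748) * ?d) * form a a = 0"
    using 4 6 by algebra
  then have d: "2 * (c^2 - 55 * c + 748) * ?d = (70 * c^2 + 955 * c + 2388) * c"
    using a(3) c0 by simp
  have "c^2 - 55 * c + 748 \<noteq> 0"
  proof
    assume 0: "c^2 - 55 * c + 748 = 0"
    then have "70 * c^2 + 955 * c + 2388 = 0"
      using d c0 by simp
    \<comment> \<open>The remainder of the numerator's quadratic factor modulo the denominator has the root 52/5, at which the denominator is not 0.\<close>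
    then have "4805 * c = 49972" using 0 by algebra
    then have "c = 52 / 5" by (simp add: field_simps)
    from 0[unfolded this] show False by (simp add: power2_eq_square)
  qed
  then have "2 * (c^2 - 55 * c + 748) \<noteq> 0"
    by (metis mult_eq_0_iff zero_neq_numeral)
  then show ?thesis
    by (metis d nonzero_mult_div_cancel_left)
qed

text \<open>
  The formulas for \<open>tr2 a\<close> in weights 6 and 8 differ by a multiple of
  $(d-1)(c-24)(5c+44)(5c-142)$. As \<open>d\<close> is not 1, only three values of \<open>c\<close> remain, and at each of them
  the rational function of class $\mathcal S^6$ and the one claimed here agree.
\<close>

lemma dimension_class_8:
  assumes S: "class_S n" "8 \<le> n" and e: "proper_idempotent e"
    and c: "c * (2 * c - 1) * (3 * c + 46) * (5 * c + 3) * (5 * c + 22) * (7 * c + 68) \<noteq> 0"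
  shows "of_nat (card S) = (5250 * c^5 + 155250 * c^4 + 1369715 * c^3 + 3507098 * c^2 + 1497768 * c) /
            (125 * c^4 - 4770 * c^3 - 23382 * c^2 + 1561868 * c + 1032240)"
proof -
  let ?d = "of_nat (card S) :: complex"
  have c0: "c \<noteq> 0" using c by simp
  obtain a where a: "a \<in> griess" "form om a = 0" "form a a \<noteq> 0"
    using primary_vector_from_idempotent[OF e c0] by blast
  have 6: "4 * (c * (2 * c - 1) * (5 * c + 22) * (7 * c + 68)) * tr2 a =
      (2480 * c^3 + 21824 * c^2 + (- 240 * c^3 + 8672 * c^2 + 79936 * c - 47872) * ?d) * form a a"
    using trace_6[OF a(1,2) S(1)] S(2) by simp
  have 8: "9 * (c * (2 * c - 1) * (3 * c + 46) * (5 * c + 3) * (5 * c + 22) * (7 * c + 68)) * tr2 a =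
    (84000 * c^5 + 2057100 * c^4 + 12572040 * c^3 + 8575776 * c^2
     + (- 8400 * c^5 + 176700 * c^4 + 7220544 * c^3 + 42263136 * c^2 - 923040 * c - 14864256) * ?d)
    * form a a"
    using trace_8[OF a(1,2) S] .
  have "48 * c^2 * (c - 24) * (5 * c + 44) * (5 * c - 142) * (?d - 1) * form a a = 0"
    using 6 8 by algebra
  moreover have "?d \<noteq> 1"
    using card_S_neq_1[OF a c0] by (metis of_nat_1 of_nat_eq_iff)
  ultimately have "c - 24 = 0 \<or> 5 * c + 44 = 0 \<or> 5 * c - 142 = 0"
    using a(3) c0 by simp
  then consider "c = 24" | "c = - 44 / 5" | "c = 142 / 5"
    by (auto simp: field_simps eq_neg_iff_add_eq_0)
  moreover from S e have "?d = (70 * c^2 + 955 * c + 2388) * c / (2 * (c^2 - 55 * c + 748))"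
    by (intro dimension_class_6[of n]) (use c in auto)
  note d = this
  ultimately show ?thesis
  proof cases
    case 1
    show ?thesis unfolding d unfolding 1 by simp
  next
    case 2
    show ?thesis unfolding d unfolding 2 by (simp add: power_divide)
  next
    case 3
    show ?thesis unfolding d unfolding 3 by (simp add: power_divide)
  qed
qed

end

theorem mainTheorem5:
  fixes scale :: "complex \<Rightarrow> 'v::ab_group_add \<Rightarrow> 'v"
    and prd :: "'v \<Rightarrow> int \<Rightarrow> 'v \<Rightarrow> 'v"
    and vac om :: 'v
    and c d :: complex
  assumes "vertex_operator_algebra scale prd vac om c"
    and "vertex_operator_algebra.wt scale prd om 0 = module.span scale {vac}"
    and "vertex_operator_algebra.wt scale prd om 1 = {0}"
    and "vertex_operator_algebra.form_nondegenerate scale prd vac om"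
    and "\<exists>e. vertex_operator_algebra.proper_idempotent scale prd vac om c e"
    and "d = of_nat (vector_space.dim scale (vertex_operator_algebra.griess scale prd om))"
  shows
    "(vertex_operator_algebra.class_S scale prd vac om 6 \<and>
        c * (2 * c - 1) * (5 * c + 22) * (7 * c + 68) \<noteq> 0 \<longrightarrow>
        d = (70 * c^2 + 955 * c + 2388) * c / (2 * (c^2 - 55 * c + 748))) \<and>
     (vertex_operator_algebra.class_S scale prd vac om 8 \<and>
        c * (2 * c - 1) * (3 * c + 46) * (5 * c + 3) * (5 * c + 22) * (7 * c + 68) \<noteq> 0 \<longrightarrow>
        d = (5250 * c^5 + 155250 * c^4 + 1369715 * c^3 + 3507098 * c^2 + 1497768 * c) /
            (125 * c^4 - 4770 * c^3 - 23382 * c^2 + 1561868 * c + 1032240))"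
proof -
  interpret vertex_operator_algebra scale prd vac om c by (rule assms(1))
  interpret griess_voa scale prd vac om c
    by unfold_locales (use assms(2-4) in auto)
  obtain e where e: "proper_idempotent e" using assms(5) by blast
  obtain S du where S: "dual_basis S du" "card S = dim griess"
    using dual_basis_exists by blast
  interpret griess_casimir scale prd vac om c S du
    by unfold_locales (rule S(1))
  have d: "d = of_nat (card S)"
    using assms(6) S(2) by simp
  show ?thesis
    unfolding d using dimension_class_6[OF _ order_refl e] dimension_class_8[OF _ order_refl e] by blast
qed

end
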